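(* For every integer $n\ge 1$: $$\overline{N}(0,4,n)>\overline{N}(1,4,n)\quad\text{if } n \text{ is odd},$$ $$\overline{N}(0,4,n)<\overline{N}(1,4,n)\quad\text{if } n \text{ is even},$$ $$\overline{N}(1,4,n)<\overline{N}(2,4,n)\quad\text{if } n \text{ is odd},$$ $$\overline{N}(1,4,n)>\overline{N}(2,4,n)\quad\text{if } n \text{ is even},$$ and $$\overline{N}(0,4,n)-\overline{N}(2,4,n)=\begin{cases}0 & \text{if } n \text{ is not a square},\\ 2 & \text{if } n \text{ is a square}.\end{cases}$$
   Context: An overpartition of a positive integer $n$ is a partition of $n$ (a non-increasing sequence of positive integers with sum $n$) in which the first occurrence of each distinct part may or may not be overlined. The rank of an overpartition is its largest part minus its number of parts (overlines are ignored). $\overline{N}(a,c,n)$ denotes the number of overpartitions of $n$ whose rank is congruent to $a$ modulo $c$.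
   Formalization: The inequality N̄(1,4,n) < N̄(2,4,n) for odd n is stated only for n ≠ 1: both overpartitions of 1 have rank 0, so N̄(1,4,1) = N̄(2,4,1) = 0 and the strict inequality fails at n = 1. *)

theory Defs
  imports "HOL-Number_Theory.Cong"
begin

text \<open>
  An overpartition is the list of its parts in non-increasing order, each paired with a flag
  telling whether that occurrence is overlined.
\<close>

definition overpartition :: "nat \<Rightarrow> (nat \<times> bool) list \<Rightarrow> bool" where
  "overpartition n p \<longleftrightarrow>
     sorted_wrt (\<ge>) (map fst p) \<and> (\<forall>x \<in> set p. 0 < fst x) \<and> sum_list (map fst p) = n \<and>
     (\<forall>i < length p. snd (p ! i) \<longrightarrow> (\<forall>j < i. fst (p ! j) \<noteq> fst (p ! i)))"

text \<open>Meaningful for non-empty lists only, i.e. for overpartitions of positive integers.\<close>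

definition overpartition_rank :: "(nat \<times> bool) list \<Rightarrow> int" where
  "overpartition_rank p = int (Max (set (map fst p))) - int (length p)"

definition Nbar :: "int \<Rightarrow> int \<Rightarrow> nat \<Rightarrow> nat" where
  "Nbar a c n = card {p. overpartition n p \<and> [overpartition_rank p = a] (mod c)}"

lemma finite_overpartitions: "finite {p. overpartition n p}"
proof -
  have "length p \<le> sum_list (map fst p)" if "\<forall>x \<in> set p. 0 < fst x" for p :: "(nat \<times> bool) list"
    using that by (induction p) auto
  moreover have "fst x \<le> sum_list (map fst p)" if "x \<in> set p" for p :: "(nat \<times> bool) list" and x
    using that by (auto intro: member_le_sum_list)
  ultimately have "{p. overpartition n p} \<subseteq>
      {p. set p \<subseteq> {..n} \<times> (UNIV :: bool set) \<and> length p \<le> n}"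
    unfolding overpartition_def by fastforce
  then show ?thesis
    by (rule finite_subset) (intro finite_lists_length_le, simp)
qed

lemma overpartition_1_iff: "overpartition 1 p \<longleftrightarrow> p = [(1, False)] \<or> p = [(1, True)]"
proof
  assume p: "overpartition 1 p"
  then obtain x q where xq: "p = x # q"
    by (cases p) (auto simp: overpartition_def)
  have "q = []"
    using p by (cases q) (auto simp: overpartition_def xq)
  then show "p = [(1, False)] \<or> p = [(1, True)]"
    using p by (cases x) (auto simp: overpartition_def xq)
qed (auto simp: overpartition_def)

text \<open>
  Both overpartitions of 1 have rank 0, so the strict inequality between the residue classes
  1 and 2 modulo 4 fails for \<^term>\<open>n = (1::nat)\<close>.
\<close>

lemma Nbar_4_1: "Nbar 0 4 1 = 2" "Nbar 1 4 1 = 0" "Nbar 2 4 1 = 0"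
proof -
  have *: "{p. overpartition 1 p \<and> [overpartition_rank p = a] (mod 4)} =
      (if [0 = a] (mod 4) then {[(1, False)], [(1, True)]} else {})" for a
    by (auto simp: overpartition_1_iff[simplified] overpartition_rank_def)
  show "Nbar 0 4 1 = 2" "Nbar 1 4 1 = 0" "Nbar 2 4 1 = 0"
    unfolding Nbar_def * by (simp_all add: cong_def)
qed

end

theory Submission
  imports Defs "HOL-Analysis.Infinite_Sum" "HOL-Analysis.Elementary_Metric_Spaces"
    "HOL-Computational_Algebra.Formal_Power_Series"
begin

text \<open>
  Let \<open>R(z) = \<Sum> z^rank q^size\<close> be the rank generating function.

  At \<open>z = \<i>\<close>, splitting off the first row and the first column of the Ferrers diagram
  (iterated: the Durfee square) collapses \<open>R(\<i>)\<close> to \<open>1 + 2 \<Sum> q^(n^2)\<close>, which yields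
  the last claim and equality of the residue classes 1 and 3.

  At \<open>z = -1\<close>, the overpartition analogue of Dyson's symmetry argument gives
  \<open>\<theta>(-q) R(-1) = 1 + 8 \<Sum> (-1)^(m+k-1) m q^(k^2+mk)\<close> with \<open>\<theta>(q) = \<Sum> q^(k^2)\<close>.
  A Kronecker-type class number relation identifies the solution of this equation: up to the sign
  \<open>(-1)^(n+1)\<close>, the coefficient of \<open>q^n\<close> in \<open>R(-1)\<close> is four times the weighted number of
  triples \<open>(s, t, z)\<close> with \<open>n = s^2 - t^2 + 2sz\<close>, \<open>s > 0\<close>, \<open>\<bar>t\<bar> \<le> s\<close>, \<open>z \<ge> 0\<close>, where each
  of the boundary conditions \<open>\<bar>t\<bar> = s\<close> and \<open>z = 0\<close> costs a factor 1/2. The triples with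
  \<open>s = 1\<close> already contribute 4 if \<open>n \<ge> 2\<close>, which beats the correction 2 at squares.

  To verify the relation, shift the summation index in \<open>\<theta>(q) q^(-t^2)\<close> and sum over \<open>t\<close>.
  With \<open>c_j = (1 + q^(2j)) / (1 - q^(2j))\<close> this produces \<open>\<Sum> (c_s c_(s+m) - 1) q^(m^2)\<close>,
  which telescopes in \<open>s\<close> by the addition theorem of the hyperbolic cotangent.
\<close>

unbundle fps_syntax

section \<open>Overpartitions by largest part and number of parts\<close>

text \<open>
  Overpartitions with largest part \<open>l\<close> and \<open>k\<close> parts. The value 2 at \<open>(0, 0)\<close> counts
  nothing; it makes the recurrence hold for \<open>l = 1\<close> or \<open>k = 1\<close> as well.
\<close>

fun rank_fps :: "nat \<Rightarrow> nat \<Rightarrow> 'a::comm_ring_1 fps" where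
  "rank_fps 0 0 = 2"
| "rank_fps 0 (Suc k) = 0"
| "rank_fps (Suc l) 0 = 0"
| "rank_fps (Suc l) (Suc k) =
     fps_X * rank_fps l (Suc k) + fps_X ^ Suc l * (rank_fps (Suc l) k + rank_fps l k)"

lemma rank_fps_0_left: "k > 0 \<Longrightarrow> rank_fps 0 k = 0"
  and rank_fps_0_right: "l > 0 \<Longrightarrow> rank_fps l 0 = 0"
  by (cases k; simp) (cases l; simp)

text \<open>
  The relation \<open>rank_fps_cross\<close> below is the difference between the defining recurrence and its
  mirror image, divided by \<open>X\<close>. Proving it by induction yields the conjugation symmetry without a
  bijection.
\<close>

lemma cross_relation_step:
  fixes x p q B C D F G H J M :: "'a::comm_ring_1"
  assumes B: "B = x * D + x * (x * q) * (F + G)" and C: "C = x * D + x * (x * p) * (H + J)"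
    and z1: "(1 - x * q) * F - (1 - p) * D = (x * q - p) * G"
    and z2: "(1 - q) * D - (1 - x * p) * H = (q - x * p) * J"
    and I: "D = x * G + x * p * (J + M)" and II: "D = x * J + x * q * (G + M)"
  shows "(1 - x * q) * B - (1 - x * p) * C = (x * q - x * p) * D"
proof -
  \<comment> \<open>After expanding \<open>B\<close> and \<open>C\<close> the claim is an explicit
    linear combination of \<open>z1\<close>, \<open>z2\<close>, \<open>I\<close> and
    \<open>II\<close>. No division is involved, so any commutative ring will do.\<close>
  have "(1 - x * q) * B - (1 - x * p) * C - (x * q - x * p) * D =
      x * x * q * ((1 - x * q) * F - (1 - p) * D - (x * q - p) * G)
    + x * x * p * ((1 - q) * D - (1 - x * p) * H - (q - x * p) * J)
    + x * p * (D - (x * J + x * q * (G + M))) - x * q * (D - (x * G + x * p * (J + M)))"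
    unfolding B C by (simp add: algebra_simps)
  also have "\<dots> = 0"
    using z1 z2 I II by simp
  finally show ?thesis by simp
qed

lemma mirror_step:
  fixes x p q B C D :: "'a::comm_ring_1"
  assumes "(1 - q) * B - (1 - p) * C = (q - p) * D"
  shows "x * B + x * p * (C + D) = x * C + x * q * (B + D)"
proof -
  have "x * B + x * p * (C + D) - (x * C + x * q * (B + D)) =
      x * ((1 - q) * B - (1 - p) * C - (q - p) * D)"
    by (simp add: algebra_simps)
  then show ?thesis
    using assms by simp
qed

lemma rank_fps_cross:
  "(1 - fps_X ^ k) * rank_fps l (Suc k) - (1 - fps_X ^ l) * rank_fps (Suc l) k =
   (fps_X ^ k - fps_X ^ l) * (rank_fps l k :: 'a::comm_ring_1 fps)"
proof (induction "l + k" arbitrary: l k rule: less_induct)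
  case less
  let ?E = "rank_fps :: nat \<Rightarrow> nat \<Rightarrow> 'a fps"
  let ?x = "fps_X :: 'a fps"
  \<comment> \<open>The mirrored recurrence at \<open>(Suc i, Suc j)\<close> costs only the cross
    relation at \<open>(i, j)\<close>, which the induction on \<open>l + k\<close> supplies.\<close>
  have mirror: "?E (Suc i) (Suc j) = ?x * ?E (Suc i) j + ?x ^ Suc j * (?E i (Suc j) + ?E i j)"
    if "i + j < l + k" for i j
    using mirror_step[OF less[OF that], of ?x] by simp
  show ?case
  proof (cases "l = 0 \<or> k = 0")
    case True
    then show ?thesis by (cases l; cases k) auto
  next
    case False
    then obtain a b where ab: "l = Suc a" "k = Suc b"
      by (auto simp: gr0_conv_Suc)
    show ?thesis
      unfolding ab power_Suc
    proof (rule cross_relation_step)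
      show "?E (Suc a) (Suc (Suc b)) =
          ?x * ?E (Suc a) (Suc b) + ?x * (?x * ?x ^ b) * (?E a (Suc (Suc b)) + ?E a (Suc b))"
        using mirror[of a "Suc b"] ab by (simp only: power_Suc)
      show "?E (Suc (Suc a)) (Suc b) =
          ?x * ?E (Suc a) (Suc b) + ?x * (?x * ?x ^ a) * (?E (Suc (Suc a)) b + ?E (Suc a) b)"
        by (simp only: rank_fps.simps power_Suc)
      show "(1 - ?x * ?x ^ b) * ?E a (Suc (Suc b)) - (1 - ?x ^ a) * ?E (Suc a) (Suc b) =
          (?x * ?x ^ b - ?x ^ a) * ?E a (Suc b)"
        using less[of a "Suc b"] ab by (simp only: power_Suc)
      show "(1 - ?x ^ b) * ?E (Suc a) (Suc b) - (1 - ?x * ?x ^ a) * ?E (Suc (Suc a)) b =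
          (?x ^ b - ?x * ?x ^ a) * ?E (Suc a) b"
        using less[of "Suc a" b] ab by (simp only: power_Suc)
      show "?E (Suc a) (Suc b) = ?x * ?E a (Suc b) + ?x * ?x ^ a * (?E (Suc a) b + ?E a b)"
        by (simp only: rank_fps.simps power_Suc)
      show "?E (Suc a) (Suc b) = ?x * ?E (Suc a) b + ?x * ?x ^ b * (?E a (Suc b) + ?E a b)"
        using mirror[of a b] ab by (simp only: power_Suc)
    qed
  qed
qed

lemma rank_fps_Suc_Suc':
  "rank_fps (Suc l) (Suc k) =
     fps_X * rank_fps (Suc l) k + fps_X ^ Suc k * (rank_fps l (Suc k) + rank_fps l k)"
  using mirror_step[OF rank_fps_cross[of k l], of fps_X] by simp

text \<open>The mirrored recurrence at \<open>(l, k)\<close> is the defining one at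
  \<open>(k, l)\<close>, and the boundary values are symmetric.\<close>

lemma rank_fps_sym: "rank_fps l k = (rank_fps k l :: 'a::comm_ring_1 fps)"
proof (induction "l + k" arbitrary: l k rule: less_induct)
  case less
  show ?case
  proof (cases "l = 0 \<or> k = 0")
    case True
    then show ?thesis by (cases l; cases k) auto
  next
    case False
    then obtain a b where ab: "l = Suc a" "k = Suc b"
      by (auto simp: gr0_conv_Suc)
    have "rank_fps (Suc a) b = (rank_fps b (Suc a) :: 'a fps)"
         "rank_fps a (Suc b) = (rank_fps (Suc b) a :: 'a fps)"
         "rank_fps a b = (rank_fps b a :: 'a fps)"
      by (intro less; simp add: ab)+
    then show ?thesis
      unfolding ab rank_fps_Suc_Suc'[of a b] rank_fps.simps(4)[of b a] by simp
  qed
qed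

text \<open>The largest part is at most the size. Together with its mirror image this cuts every sum
  over shapes down to the box \<open>1..n\<close> in the coefficient of index
  \<open>n\<close>.\<close>

lemma rank_fps_nth_eq_0_left: "n < l \<Longrightarrow> rank_fps l k $ n = 0"
proof (induction l k arbitrary: n rule: rank_fps.induct)
  case (4 l k)
  then show ?case
    by (cases n) (auto simp: fps_X_power_mult_nth simp del: power_Suc)
qed auto

lemma rank_fps_nth_eq_0_right: "n < k \<Longrightarrow> rank_fps l k $ n = 0"
  using rank_fps_nth_eq_0_left[of n k l] by (simp add: rank_fps_sym)

text \<open>The possible tails of an overpartition with first part \<open>l\<close>.\<close>

definition bounded_overpartitions :: "nat \<Rightarrow> nat \<Rightarrow> nat \<Rightarrow> (nat \<times> bool) list set" where
  "bounded_overpartitions l k n =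
     {r. overpartition n r \<and> length r = k \<and> (\<forall>x\<in>set r. fst x < l \<or> fst x = l \<and> \<not> snd x)}"

section \<open>Counting overpartitions of a given shape by removing the first part\<close>

lemma overpartition_alt:
  "overpartition n p \<longleftrightarrow>
     sorted_wrt (\<lambda>x y. fst y \<le> fst x \<and> (snd y \<longrightarrow> fst x \<noteq> fst y)) p \<and>
     (\<forall>x\<in>set p. 0 < fst x) \<and> sum_list (map fst p) = n"
  unfolding overpartition_def sorted_wrt_map sorted_wrt_iff_nth_less
  by (auto dest: less_trans)

lemma overpartition_Nil: "overpartition n [] \<longleftrightarrow> n = 0"
  by (auto simp: overpartition_alt)

text \<open>The flag \<open>b\<close> is free, because the head is the first occurrence of
  \<open>l\<close>; later copies of \<open>l\<close> must be plain. This freedom is the source of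
  the factors 2 below.\<close>

lemma overpartition_Cons:
  "overpartition n ((l, b) # r) \<longleftrightarrow>
     0 < l \<and> l \<le> n \<and> r \<in> bounded_overpartitions l (length r) (n - l)"
  unfolding bounded_overpartitions_def overpartition_alt by force

lemma finite_bounded_overpartitions [simp]: "finite (bounded_overpartitions l k n)"
  by (rule finite_subset[OF _ finite_overpartitions[of n]])
    (auto simp: bounded_overpartitions_def)

lemma bounded_overpartitions_0:
  "bounded_overpartitions l 0 n = (if n = 0 then {[]} else {})"
  by (auto simp: bounded_overpartitions_def overpartition_Nil)

lemma Cons_in_bounded_overpartitions:
  "(a, b) # r \<in> bounded_overpartitions l (Suc k) n \<longleftrightarrow>
     0 < a \<and> a \<le> n \<and> r \<in> bounded_overpartitions a k (n - a) \<and> (a < l \<or> a = l \<and> \<not> b)"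
proof -
  have "(a, b) # r \<in> bounded_overpartitions l (Suc k) n \<longleftrightarrow> overpartition n ((a, b) # r) \<and>
      length r = k \<and> (a < l \<or> a = l \<and> \<not> b) \<and> (\<forall>x\<in>set r. fst x < l \<or> fst x = l \<and> \<not> snd x)"
    unfolding bounded_overpartitions_def by auto
  also have "\<dots> \<longleftrightarrow> 0 < a \<and> a \<le> n \<and> r \<in> bounded_overpartitions a k (n - a) \<and> (a < l \<or> a = l \<and> \<not> b)"
    unfolding overpartition_Cons unfolding bounded_overpartitions_def by fastforce
  finally show ?thesis .
qed

lemma bounded_overpartitions_0_left: "bounded_overpartitions 0 (Suc k) n = {}"
proof -
  have "r \<notin> bounded_overpartitions 0 (Suc k) n" for r
  proof (cases r)
    case (Cons x r')
    then show ?thesis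
      by (cases x) (auto simp: Cons_in_bounded_overpartitions)
  qed (simp add: bounded_overpartitions_def)
  then show ?thesis by blast
qed

text \<open>Classification by the head: it is already admissible for the bound \<open>l\<close>, or
  it is an overlined \<open>l\<close>, or it is a plain \<open>Suc l\<close>.\<close>

lemma card_bounded_overpartitions_Suc_Suc:
  "card (bounded_overpartitions (Suc l) (Suc k) n) =
     card (bounded_overpartitions l (Suc k) n)
     + (if 0 < l \<and> l \<le> n then card (bounded_overpartitions l k (n - l)) else 0)
     + (if Suc l \<le> n then card (bounded_overpartitions (Suc l) k (n - Suc l)) else 0)"
proof -
  define A where "A = bounded_overpartitions l (Suc k) n"
  define B where "B = (if 0 < l \<and> l \<le> n then Cons (l, True) ` bounded_overpartitions l k (n - l) else {})"
  define C where
    "C = (if Suc l \<le> n then Cons (Suc l, False) ` bounded_overpartitions (Suc l) k (n - Suc l) else {})"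
  have "r \<in> bounded_overpartitions (Suc l) (Suc k) n \<longleftrightarrow> r \<in> A \<union> B \<union> C" for r
  proof (cases r)
    case Nil
    then show ?thesis by (auto simp: A_def B_def C_def bounded_overpartitions_def)
  next
    case (Cons x r')
    then show ?thesis
      by (cases x) (auto simp: A_def B_def C_def Cons_in_bounded_overpartitions less_Suc_eq)
  qed
  then have "bounded_overpartitions (Suc l) (Suc k) n = A \<union> B \<union> C" by blast
  moreover have "A \<inter> B = {}" "(A \<union> B) \<inter> C = {}"
    by (auto simp: A_def B_def C_def Cons_in_bounded_overpartitions)
  moreover have "finite A" "finite B" "finite C"
    by (auto simp: A_def B_def C_def)
  ultimately have "card (bounded_overpartitions (Suc l) (Suc k) n) = card A + card B + card C"
    by (simp add: card_Un_disjoint)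
  moreover have "card B = (if 0 < l \<and> l \<le> n then card (bounded_overpartitions l k (n - l)) else 0)"
    "card C = (if Suc l \<le> n then card (bounded_overpartitions (Suc l) k (n - Suc l)) else 0)"
    by (auto simp: B_def C_def card_image)
  ultimately show ?thesis by (simp add: A_def)
qed

lemma rank_fps_nth_Suc_Suc:
  "rank_fps (Suc l) (Suc k) $ (n + Suc l) =
     rank_fps l (Suc k) $ (n + l) + rank_fps (Suc l) k $ n + (rank_fps l k $ n :: 'a::comm_ring_1)"
  by (simp add: fps_X_power_mult_nth del: power_Suc)

text \<open>Prepending a first part \<open>l\<close> with either flag accounts for the factor 2, the
  additional part and the shift of the size by \<open>l\<close>.\<close>

lemma card_bounded_overpartitions:
  assumes "l > 0"
  shows "(of_nat (2 * card (bounded_overpartitions l k n)) :: 'a::comm_ring_1) =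
         rank_fps l (Suc k) $ (n + l)"
  using assms
proof (induction k arbitrary: l n)
  case 0
  have "rank_fps l (Suc 0) $ (n + l) = (if n = 0 then 2 else 0 :: 'a)"
    using 0
  proof (induction l rule: nat_induct_non_zero)
    case 1
    then show ?case using rank_fps_nth_Suc_Suc[of 0 0 n, where 'a = 'a]
      by (simp add: fps_numeral_nth del: rank_fps.simps(4))
  next
    case (Suc l)
    then show ?case using rank_fps_nth_Suc_Suc[of l 0 n, where 'a = 'a]
      by (simp add: rank_fps_0_right del: rank_fps.simps(4))
  qed
  then show ?case by (simp add: bounded_overpartitions_0)
next
  case (Suc k)
  \<comment> \<open>The case distinction guards against truncated subtraction; for
    \<open>n < l\<close> both sides vanish.\<close>
  have key: "of_nat (2 * (if l \<le> n then card (bounded_overpartitions l k (n - l)) else 0)) =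
      (rank_fps l (Suc k) $ n :: 'a)" if "l > 0" for l n
    using Suc.IH[OF that, of "n - l"] by (auto simp: rank_fps_nth_eq_0_left)
  have "(of_nat (2 * card (bounded_overpartitions l (Suc k) n)) :: 'a) =
      (if l = 0 then 0 else rank_fps l (Suc (Suc k)) $ (n + l))" for l n
  proof (induction l)
    case 0
    then show ?case by (simp add: bounded_overpartitions_0_left)
  next
    case (Suc l)
    have "(of_nat (2 * card (bounded_overpartitions (Suc l) (Suc k) n)) :: 'a) =
        of_nat (2 * card (bounded_overpartitions l (Suc k) n))
        + (if l = 0 then 0 else rank_fps l (Suc k) $ n) + rank_fps (Suc l) (Suc k) $ n"
      unfolding key[of "Suc l" n, OF zero_less_Suc, symmetric]
      using key[of l n]
      by (cases "l = 0")
        (simp_all add: card_bounded_overpartitions_Suc_Suc algebra_simps del: rank_fps.simps(4))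
    also have "\<dots> = rank_fps (Suc l) (Suc (Suc k)) $ (n + Suc l)"
      unfolding Suc.IH rank_fps_nth_Suc_Suc
      by (simp add: rank_fps_0_left del: rank_fps.simps(4))
    finally show ?case by simp
  qed
  then show ?case using Suc.prems by simp
qed

definition overpartitions_shape :: "nat \<Rightarrow> nat \<Rightarrow> nat \<Rightarrow> (nat \<times> bool) list set" where
  "overpartitions_shape l k n = {p. overpartition n p \<and> p \<noteq> [] \<and> fst (hd p) = l \<and> length p = k}"

lemma card_overpartitions_shape:
  assumes "l > 0" "k > 0"
  shows "(of_nat (card (overpartitions_shape l k n)) :: 'a::comm_ring_1) = rank_fps l k $ n"
proof -
  obtain k' where k: "k = Suc k'" using assms by (cases k) auto
  have mem: "p \<in> overpartitions_shape l k n \<longleftrightarrow>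
      l \<le> n \<and> (\<exists>b. \<exists>r\<in>bounded_overpartitions l k' (n - l). p = (l, b) # r)" for p
  proof (cases p)
    case (Cons x r)
    then show ?thesis
      using assms k by (cases x) (auto simp: overpartitions_shape_def overpartition_Cons bounded_overpartitions_def)
  qed (auto simp: overpartitions_shape_def)
  show ?thesis
  proof (cases "l \<le> n")
    case False
    then have "overpartitions_shape l k n = {}" using mem by blast
    then show ?thesis using False by (simp add: rank_fps_nth_eq_0_left)
  next
    case True
    have "overpartitions_shape l k n =
        (\<lambda>(b, r). (l, b) # r) ` (UNIV \<times> bounded_overpartitions l k' (n - l))"
      using True by (auto simp: mem image_iff)
    then have "card (overpartitions_shape l k n) = 2 * card (bounded_overpartitions l k' (n - l))"
      by (simp add: card_image inj_on_def card_cartesian_product)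
    then show ?thesis
      using card_bounded_overpartitions[OF assms(1), of k' "n - l", where 'a = 'a] True k by simp
  qed
qed

text \<open>The rank depends on the shape only, and the shapes in the box \<open>1..n\<close> times
  \<open>1..n\<close> split the overpartitions of \<open>n\<close> into disjoint classes.\<close>

lemma Nbar_eq_sum:
  assumes "n > 0"
  shows "Nbar a c n =
    (\<Sum>l=1..n. \<Sum>k=1..n. if [int l - int k = a] (mod c) then card (overpartitions_shape l k n) else 0)"
proof -
  have rank: "overpartition_rank p = int (fst (hd p)) - int (length p)"
    if "overpartition n p" "p \<noteq> []" for p
  proof -
    have "Max (set (map fst p)) = fst (hd p)"
      using that by (intro Max_eqI) (cases p; auto simp: overpartition_def)+
    then show ?thesis by (simp add: overpartition_rank_def)
  qed
  define I where "I = {(l, k). l \<in> {1..n} \<and> k \<in> {1..n} \<and> [int l - int k = a] (mod c)}"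
  have fin: "finite I"
    by (rule finite_subset[of _ "{1..n} \<times> {1..n}"]) (auto simp: I_def)
  have bounds: "fst (hd p) \<in> {1..n} \<and> length p \<in> {1..n}" if p: "overpartition n p" "p \<noteq> []" for p
  proof -
    have "\<forall>x\<in>set p. 0 < fst x" "sum_list (map fst p) = n"
      using p by (auto simp: overpartition_def)
    moreover have "length q \<le> sum_list (map fst q)" if "\<forall>x\<in>set q. 0 < fst x" for q :: "(nat \<times> bool) list"
      using that by (induction q) auto
    ultimately have "length p \<le> n"
      by metis
    moreover have "0 < fst (hd p)" "fst (hd p) \<le> n"
      using p by (cases p; auto simp: overpartition_def)+
    ultimately show ?thesis using p(2)
      by (auto simp: Suc_le_eq)
  qed
  have ne: "p \<noteq> []" if "overpartition n p" for p
    using that assms by (auto simp: overpartition_Nil)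
  have "{p. overpartition n p \<and> [overpartition_rank p = a] (mod c)} =
      (\<Union>(l, k)\<in>I. overpartitions_shape l k n)"
    using ne bounds rank by (fastforce simp: I_def overpartitions_shape_def)
  then have "Nbar a c n = card (\<Union>(l, k)\<in>I. overpartitions_shape l k n)"
    by (simp add: Nbar_def)
  also have "\<dots> = (\<Sum>i\<in>I. card (case i of (l, k) \<Rightarrow> overpartitions_shape l k n))"
  proof (rule card_UN_disjoint[OF fin])
    show "\<forall>i\<in>I. finite (case i of (l, k) \<Rightarrow> overpartitions_shape l k n)"
      using finite_subset[OF _ finite_overpartitions[of n]]
      by (auto simp: overpartitions_shape_def)
  qed (auto simp: overpartitions_shape_def)
  also have "\<dots> = (\<Sum>i\<in>{1..n} \<times> {1..n}. if i \<in> I then card (case i of (l, k) \<Rightarrow> overpartitions_shape l k n) else 0)"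
    by (rule sum.mono_neutral_cong_left) (auto simp: I_def)
  also have "\<dots> = (\<Sum>l=1..n. \<Sum>k=1..n. if [int l - int k = a] (mod c) then card (overpartitions_shape l k n) else 0)"
    unfolding sum.cartesian_product by (rule sum.cong) (auto simp: I_def split: if_splits)
  finally show ?thesis .
qed

section \<open>Evaluation at the fourth root of unity\<close>

text \<open>\<open>u\<close> marks the largest part and \<open>v\<close> the number of parts, so
  \<open>u * v = 1\<close> yields \<open>u\<close> to the power of the rank. The parameters
  \<open>a\<close> and \<open>b\<close> replace \<open>u\<close> by \<open>u * q^a\<close> and
  \<open>v\<close> by \<open>v * q^b\<close>; raising \<open>a\<close> absorbs the factor
  \<open>X^l\<close> of the recurrence.\<close>

definition rank_term :: "'a::comm_ring_1 \<Rightarrow> 'a \<Rightarrow> nat \<Rightarrow> nat \<Rightarrow> nat \<Rightarrow> nat \<Rightarrow> 'a fps" where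
  "rank_term u v a b l k = fps_const (u ^ l * v ^ k) * (fps_X ^ (a * l + b * k) * rank_fps l k)"

definition rank_gf :: "'a::comm_ring_1 \<Rightarrow> 'a \<Rightarrow> nat \<Rightarrow> nat \<Rightarrow> 'a fps" where
  "rank_gf u v a b = Abs_fps (\<lambda>n. \<Sum>l=1..n. \<Sum>k=1..n. rank_term u v a b l k $ n)"

lemma rank_term_nth_eq_0:
  "n < l \<or> n < k \<Longrightarrow> rank_term u v a b l k $ n = 0"
  by (auto simp: rank_term_def fps_X_power_mult_nth rank_fps_nth_eq_0_left rank_fps_nth_eq_0_right)

text \<open>Any sufficiently large box gives the same coefficient. A common box for all coefficients
  up to \<open>n\<close> is what allows the recurrence to be summed.\<close>

lemma rank_gf_nth:
  assumes "n < N"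
  shows "rank_gf u v a b $ n = (\<Sum>l<N. \<Sum>k<N. rank_term u v a b (Suc l) (Suc k) $ n)"
proof -
  have "rank_gf u v a b $ n = (\<Sum>l=1..N. \<Sum>k=1..N. rank_term u v a b l k $ n)"
    unfolding rank_gf_def fps_nth_Abs_fps
    using assms by (intro sum.mono_neutral_cong_left)
      (auto simp: rank_term_nth_eq_0 intro!: sum.neutral sum.mono_neutral_left)
  also have "\<dots> = (\<Sum>l<N. \<Sum>k<N. rank_term u v a b (Suc l) (Suc k) $ n)"
    by (simp add: sum.atLeast1_atMost_eq)
  finally show ?thesis .
qed

lemma rank_gf_sym: "rank_gf u v a b = rank_gf v u b a"
proof (rule fps_ext)
  fix n
  have "rank_term u v a b l k = rank_term v u b a k l" for l k
    by (simp add: rank_term_def rank_fps_sym[of k l] mult.commute add.commute)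
  then show "rank_gf u v a b $ n = rank_gf v u b a $ n"
    unfolding rank_gf_def fps_nth_Abs_fps by (subst sum.swap) simp
qed

lemma rank_term_eq:
  "rank_term u v a b l k = fps_const u ^ l * fps_const v ^ k * (fps_X ^ (a * l + b * k) * rank_fps l k)"
  unfolding rank_term_def fps_const_mult[symmetric] fps_const_power ..

lemma rank_term_Suc_Suc_aux:
  fixes U V x P Q R :: "'a::comm_ring_1"
  assumes "U * V = 1"
  shows "U ^ Suc l * V ^ Suc k * (x ^ (a * Suc l + b * Suc k) * (x * P + x ^ Suc l * (Q + R))) =
    U * x ^ Suc a * (U ^ l * V ^ Suc k * (x ^ (a * l + b * Suc k) * P))
    + V * x ^ b * (U ^ Suc l * V ^ k * (x ^ (Suc a * Suc l + b * k) * Q))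
    + x ^ (a + b + 1) * (U ^ l * V ^ k * (x ^ (Suc a * l + b * k) * R))"
    (is "?L = ?A + ?B + ?C")
proof -
  have "?L = ?A + ?B + U * V * ?C"
    by (simp add: power_add algebra_simps)
  then show ?thesis using assms by simp
qed

lemma fps_const_mult_eq_1: "u * v = 1 \<Longrightarrow> fps_const u * fps_const v = (1 :: 'a::comm_ring_1 fps)"
  by (metis fps_const_1_eq_1 fps_const_mult)

lemma rank_term_Suc_Suc:
  assumes "u * v = 1"
  shows "rank_term u v a b (Suc l) (Suc k) =
    fps_const u * fps_X ^ Suc a * rank_term u v a b l (Suc k)
    + fps_const v * fps_X ^ b * rank_term u v (Suc a) b (Suc l) k
    + fps_X ^ (a + b + 1) * rank_term u v (Suc a) b l k"
  unfolding rank_term_eq rank_fps.simps(4)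
  by (rule rank_term_Suc_Suc_aux[OF fps_const_mult_eq_1[OF assms]])

text \<open>The recurrence summed over all shapes: its first term keeps \<open>a\<close> and moves
  to the left side, the other two raise \<open>a\<close> by 1. The inhomogeneous term is the
  artificial value 2 at \<open>(0, 0)\<close>.\<close>

lemma rank_gf_step:
  assumes uv: "u * v = 1"
  shows "(1 - fps_const u * fps_X ^ Suc a) * rank_gf u v a b =
    fps_const v * fps_X ^ b * (1 + fps_const u * fps_X ^ Suc a) * rank_gf u v (Suc a) b
    + 2 * fps_X ^ (a + b + 1)"
proof (rule fps_ext)
  fix n
  define N where "N = Suc n"
  define S where "S a = (\<Sum>l<N. \<Sum>k<N. rank_term u v a b (Suc l) (Suc k))" for a
  have S: "rank_gf u v a b $ m = S a $ m" if "m < N" for a m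
    using rank_gf_nth[OF that] by (simp add: S_def fps_sum_nth)
  have S': "(f * rank_gf u v a b) $ m = (f * S a) $ m" if "m < N" for a m f
    using that S by (simp add: fps_mult_nth)
  have bd: "rank_term u v a b l 0 = 0" "rank_term u v a b 0 l = 0" if "l > 0" for l a
    using that by (simp_all add: rank_term_def rank_fps_0_left rank_fps_0_right)
  have shift_l: "(\<Sum>l<N. f l) + f N = f 0 + (\<Sum>l<N. f (Suc l))" for f :: "nat \<Rightarrow> 'a fps"
    using sum.lessThan_Suc_shift[of f N] sum.lessThan_Suc[of f N] by simp
  have diffI: "A = B - C" if "A + C = B" for A B C :: "'a fps"
    using that by (simp add: eq_diff_eq)
  \<comment> \<open>\<open>R1\<close>, \<open>R2\<close> and \<open>R3\<close> collect the terms on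
    the edge of the box, where the index shift goes wrong. All of them have order at least
    \<open>N\<close>, so they are invisible in the coefficient of index \<open>n\<close>.\<close>
  define R1 where "R1 = (\<Sum>k<N. rank_term u v a b N (Suc k))"
  define R2 where "R2 = (\<Sum>l<N. rank_term u v (Suc a) b (Suc l) N)"
  define R3 where "R3 = (\<Sum>l<N. rank_term u v (Suc a) b l N) + (\<Sum>k<N. rank_term u v (Suc a) b N (Suc k))"
  have R0: "R1 $ i = 0" "R2 $ i = 0" "R3 $ i = 0" if "i < N" for i
    using that by (simp_all add: R1_def R2_def R3_def fps_sum_nth rank_term_nth_eq_0)
  have R: "(f * R1) $ n = 0" "(f * R2) $ n = 0" "(f * R3) $ n = 0" for f
    unfolding fps_mult_nth by (auto intro!: sum.neutral simp: R0 N_def)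
  have zero_row: "(\<Sum>k<N. rank_term u v a b 0 (Suc k)) = 0" for a
    by (intro sum.neutral ballI bd(2)) simp
  have c1: "(\<Sum>l<N. \<Sum>k<N. rank_term u v a b l (Suc k)) = S a - R1"
    using shift_l[of "\<lambda>l. \<Sum>k<N. rank_term u v a b l (Suc k)"]
    unfolding S_def R1_def zero_row add_0 by (rule diffI)
  have c2: "(\<Sum>l<N. \<Sum>k<N. rank_term u v (Suc a) b (Suc l) k) = S (Suc a) - R2"
  proof -
    have "(\<Sum>k<N. rank_term u v (Suc a) b (Suc l) k) =
        (\<Sum>k<N. rank_term u v (Suc a) b (Suc l) (Suc k)) - rank_term u v (Suc a) b (Suc l) N" for l
      using shift_l[of "rank_term u v (Suc a) b (Suc l)"]
      unfolding bd(1)[OF zero_less_Suc] add_0 by (rule diffI)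
    then show ?thesis by (simp only: S_def R2_def sum_subtractf)
  qed
  have c3: "(\<Sum>l<N. \<Sum>k<N. rank_term u v (Suc a) b l k) = S (Suc a) + 2 - R3"
  proof -
    have "(\<Sum>k<N. rank_term u v (Suc a) b l k) = rank_term u v (Suc a) b l 0 +
        (\<Sum>k<N. rank_term u v (Suc a) b l (Suc k)) - rank_term u v (Suc a) b l N" for l
      using shift_l[of "rank_term u v (Suc a) b l"] by (rule diffI)
    then have "(\<Sum>l<N. \<Sum>k<N. rank_term u v (Suc a) b l k) =
        (\<Sum>l<N. rank_term u v (Suc a) b l 0) + (\<Sum>l<N. \<Sum>k<N. rank_term u v (Suc a) b l (Suc k))
        - (\<Sum>l<N. rank_term u v (Suc a) b l N)"
      by (simp only: sum_subtractf sum.distrib)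
    moreover have "(\<Sum>l<N. rank_term u v (Suc a) b l 0) = 2"
    proof -
      have "(\<Sum>l<N. rank_term u v (Suc a) b l 0) = (\<Sum>l\<in>{0}. rank_term u v (Suc a) b l 0)"
        using bd(1) by (intro sum.mono_neutral_right) (auto simp: N_def)
      then show ?thesis by (simp add: rank_term_def)
    qed
    moreover have "(\<Sum>l<N. \<Sum>k<N. rank_term u v (Suc a) b l (Suc k)) =
        S (Suc a) - (\<Sum>k<N. rank_term u v (Suc a) b N (Suc k))"
      using shift_l[of "\<lambda>l. \<Sum>k<N. rank_term u v (Suc a) b l (Suc k)"]
      unfolding S_def zero_row add_0 by (rule diffI)
    ultimately show ?thesis by (simp only: R3_def) (simp add: algebra_simps)
  qed
  have "S a = fps_const u * fps_X ^ Suc a * (S a - R1) + fps_const v * fps_X ^ b * (S (Suc a) - R2)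
      + fps_X ^ (a + b + 1) * (S (Suc a) + 2 - R3)"
    unfolding c1[symmetric] c2[symmetric] c3[symmetric]
    by (subst S_def, subst rank_term_Suc_Suc[OF uv]) (simp only: sum.distrib sum_distrib_left)
  then have "(1 - fps_const u * fps_X ^ Suc a) * S a =
      (fps_const v * fps_X ^ b + fps_X ^ (a + b + 1)) * S (Suc a) + 2 * fps_X ^ (a + b + 1)
      - fps_const u * fps_X ^ Suc a * R1 - fps_const v * fps_X ^ b * R2 - fps_X ^ (a + b + 1) * R3"
    by (simp add: algebra_simps)
  then have "((1 - fps_const u * fps_X ^ Suc a) * S a) $ n =
      ((fps_const v * fps_X ^ b + fps_X ^ (a + b + 1)) * S (Suc a)) $ n + (2 * fps_X ^ (a + b + 1)) $ n"
    using R by (simp only: fps_sub_nth fps_add_nth) simp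
  moreover have "fps_const v * fps_X ^ b + fps_X ^ (a + b + 1) =
      fps_const v * fps_X ^ b * (1 + fps_const u * fps_X ^ Suc a)"
  proof -
    note fps_const_mult_eq_1[OF uv]
    moreover have "fps_const v * fps_X ^ b * (1 + fps_const u * fps_X ^ Suc a) =
        fps_const v * fps_X ^ b + (fps_const u * fps_const v) * fps_X ^ (a + b + 1)"
      by (simp add: distrib_left mult_ac power_add del: fps_const_mult)
    ultimately show ?thesis by simp
  qed
  moreover have "n < N" by (simp add: N_def)
  ultimately show "((1 - fps_const u * fps_X ^ Suc a) * rank_gf u v a b) $ n =
    (fps_const v * fps_X ^ b * (1 + fps_const u * fps_X ^ Suc a) * rank_gf u v (Suc a) b
    + 2 * fps_X ^ (a + b + 1)) $ n"
    by (simp only: S' fps_add_nth)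
qed

text \<open>For \<open>u = \<i>\<close> the factors on both sides cancel after two steps.\<close>

lemma rank_gf_ii_step:
  "rank_gf \<i> (-\<i>) a a = fps_X ^ (2 * a + 1) * (rank_gf \<i> (-\<i>) (Suc a) (Suc a) + 2)"
proof -
  define X where "X = (fps_X :: complex fps) ^ a"
  define x where "x = (fps_X :: complex fps)"
  define I where "I = fps_const \<i>"
  define A B C where "A = rank_gf \<i> (-\<i>) a a" and "B = rank_gf \<i> (-\<i>) (Suc a) a"
    and "C = rank_gf \<i> (-\<i>) (Suc a) (Suc a)"
  have II: "I * I = -1"
    by (simp add: I_def flip: fps_const_neg)
  have I': "fps_const (-\<i>) = -I" by (simp add: I_def)
  have pow: "fps_X ^ Suc a = x * X" "fps_X ^ (a + a + 1) = x * X * X" "fps_X ^ (a + Suc a + 1) = x * x * X * X"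
    by (simp_all add: x_def X_def power_add mult_ac)
  have 1: "(1 - I * (x * X)) * A = -I * X * (1 + I * (x * X)) * B + 2 * (x * X * X)"
    using rank_gf_step[of \<i> "-\<i>" a a] unfolding pow I' A_def[symmetric] B_def[symmetric] I_def[symmetric] X_def[symmetric]
    by simp
  \<comment> \<open>The second step has to raise \<open>b\<close>. Conjugation exchanges
    \<open>a\<close> with \<open>b\<close> and \<open>\<i>\<close> with \<open>-\<i>\<close>, so the
    factor on the left of equation 2 is the one on the right of equation 1.\<close>
  have sym: "rank_gf (-\<i>) \<i> a (Suc a) = B" "rank_gf (-\<i>) \<i> (Suc a) (Suc a) = C"
    using rank_gf_sym B_def C_def by metis+
  have 2: "(1 + I * (x * X)) * B = I * (x * X) * (1 - I * (x * X)) * C + 2 * (x * x * X * X)"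
    using rank_gf_step[of "-\<i>" \<i> a "Suc a"] unfolding pow I' sym I_def[symmetric] by simp
  have "(1 - I * (x * X)) * A = -I * X * (I * (x * X) * (1 - I * (x * X)) * C + 2 * (x * x * X * X)) + 2 * (x * X * X)"
    unfolding 1 2[symmetric] by (simp only: mult.assoc)
  also have "\<dots> = (1 - I * (x * X)) * (x * X * X * (C + 2)) - (I * I + 1) * ((1 - I * (x * X)) * C * x * X * X)"
    by (simp add: algebra_simps)
  also have "\<dots> = (1 - I * (x * X)) * (x * X * X * (C + 2))"
    by (simp add: II)
  finally have "A = x * X * X * (C + 2) \<or> 1 - I * (x * X) = 0"
    by (simp only: mult_cancel_left) blast
  moreover have "(1 - I * (x * X)) $ 0 = 1"
    by (simp add: x_def)
  then have "1 - I * (x * X) \<noteq> 0"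
    by (metis fps_zero_nth zero_neq_one)
  ultimately show ?thesis
    by (simp add: A_def C_def x_def X_def mult_2 power_add)
qed

text \<open>The exponents \<open>2 * a + 1\<close> for \<open>a < J\<close> add up to
  \<open>J\<^sup>2\<close>, the area of the Durfee square.\<close>

lemma rank_gf_ii:
  "rank_gf \<i> (-\<i>) 0 0 = 2 * (\<Sum>j=1..J. fps_X ^ j\<^sup>2) + fps_X ^ J\<^sup>2 * rank_gf \<i> (-\<i>) J J"
proof (induction J)
  case (Suc J)
  have "(Suc J)\<^sup>2 = J\<^sup>2 + (2 * J + 1)" by (simp add: power2_eq_square)
  then have "fps_X ^ J\<^sup>2 * rank_gf \<i> (-\<i>) J J = fps_X ^ (Suc J)\<^sup>2 * (rank_gf \<i> (-\<i>) (Suc J) (Suc J) + 2)"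
    using rank_gf_ii_step[of J] by (simp only: power_add mult.assoc)
  then show ?case using Suc by (simp add: algebra_simps)
qed simp

lemma rank_gf_ii_nth:
  assumes "n > 0"
  shows "rank_gf \<i> (-\<i>) 0 0 $ n = (if \<exists>k. n = k\<^sup>2 then 2 else 0)"
proof -
  \<comment> \<open>With \<open>J = Suc n\<close> the remainder term starts beyond degree
    \<open>n\<close>.\<close>
  have sq: "n < (Suc n)\<^sup>2" by (simp add: power2_eq_square)
  have "rank_gf \<i> (-\<i>) 0 0 $ n = (2 * (\<Sum>j=1..Suc n. fps_X ^ j\<^sup>2)) $ n"
    using sq by (subst rank_gf_ii[of "Suc n"]) (simp add: fps_X_power_mult_nth)
  also have "\<dots> = 2 * (\<Sum>j=1..Suc n. if j\<^sup>2 = n then 1 else 0)"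
    unfolding numeral_fps_const fps_mult_left_const_nth fps_sum_nth
    by (intro arg_cong[where f = "(*) 2"] sum.cong) auto
  also have "(\<Sum>j=1..Suc n. if j\<^sup>2 = n then 1 else 0) = (if \<exists>k. n = k\<^sup>2 then 1 else (0 :: complex))"
  proof (cases "\<exists>k. n = k\<^sup>2")
    case True
    then obtain k where k: "n = k\<^sup>2" by blast
    have "k > 0" using k assms by (cases k) auto
    moreover have "k \<le> n" using k by (simp add: power2_eq_square)
    ultimately have "(\<Sum>j=1..Suc n. if j\<^sup>2 = n then 1 else 0 :: complex) = (\<Sum>j\<in>{k}. 1)"
      by (intro sum.mono_neutral_cong_right) (auto simp: k)
    then show ?thesis using True by auto
  next
    case False
    then have "j\<^sup>2 \<noteq> n" for j by metis
    then show ?thesis using False by simp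
  qed
  finally show ?thesis by simp
qed

section \<open>Dyson's recurrence and the evaluation at minus one\<close>

abbreviation rank_fps_real :: "nat \<Rightarrow> nat \<Rightarrow> real fps" where "rank_fps_real \<equiv> rank_fps"

definition overpartition_gf :: "real fps" where
  "overpartition_gf = Abs_fps (\<lambda>n. (if n = 0 then 1 else 0) + (\<Sum>l=1..n. \<Sum>k=1..n. rank_fps_real l k $ n))"

text \<open>
  The sum of the generating functions for rank at most \<open>-m\<close> and rank less than \<open>-m\<close>; unlike
  the single ones, it satisfies a recurrence without denominators.
\<close>

definition dyson_gf :: "nat \<Rightarrow> real fps" where
  "dyson_gf m = Abs_fps (\<lambda>n. \<Sum>l=1..n. \<Sum>k=1..n.
     (of_bool (l + m \<le> k) + of_bool (l + m < k)) * rank_fps_real l k $ n)"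

text \<open>The series \<open>2 * \<Sum> (-1)^(k+1) q^(k^2 + m*k)\<close> over
  \<open>k \<ge> 1\<close>; thus \<open>1 - partial_theta 0\<close> is
  \<open>\<theta>(-q)\<close>.\<close>

definition partial_theta :: "nat \<Rightarrow> real fps" where
  "partial_theta m = Abs_fps (\<lambda>n. \<Sum>k=1..n. if k\<^sup>2 + m * k = n then 2 * (-1) ^ (k + 1) else 0)"

definition alternating_rank_gf :: "real fps" where
  "alternating_rank_gf = Abs_fps (\<lambda>n. (if n = 0 then 1 else 0) + (\<Sum>l=1..n. \<Sum>k=1..n. (-1) ^ (l + k) * rank_fps_real l k $ n))"

section \<open>Column sums over shapes and Dyson's symmetry\<close>

lemma box_sum:
  assumes "n \<le> N"
  shows "(\<Sum>l=1..n. \<Sum>k=1..n. w l k * rank_fps_real l k $ n) = (\<Sum>l=1..N. \<Sum>k=1..N. w l k * rank_fps_real l k $ n)"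
  using assms by (intro sum.mono_neutral_cong_left)
    (auto simp: rank_fps_nth_eq_0_left rank_fps_nth_eq_0_right intro!: sum.neutral sum.mono_neutral_left)

lemma box_sum_swap:
  "(\<Sum>l=1..N. \<Sum>k=1..N. w l k * rank_fps_real l k $ n) = (\<Sum>l=1..N. \<Sum>k=1..N. w k l * rank_fps_real l k $ n)"
  by (subst sum.swap) (intro sum.cong refl arg_cong2[where f = "(*)"] arg_cong2[where f = fps_nth] rank_fps_sym)

text \<open>Remove the first part \<open>l\<close>, which has two possible flags. A remainder with
  largest part \<open>i < l\<close> therefore counts twice; for \<open>i = l\<close> its head must
  be plain, which halves the count. This is why thresholds occur in pairs, once weak and once
  strict.\<close>

lemma rank_fps_column:
  assumes "k > 0"
  shows "fps_X ^ l * ((\<Sum>i=1..l. rank_fps_real i k) + (\<Sum>i=1..<l. rank_fps_real i k)) = rank_fps_real l (Suc k)"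
proof (induction l)
  case (Suc l)
  have "(\<Sum>i=1..Suc l. rank_fps_real i k) + (\<Sum>i=1..<Suc l. rank_fps_real i k) =
      ((\<Sum>i=1..l. rank_fps_real i k) + (\<Sum>i=1..<l. rank_fps_real i k)) + (rank_fps_real (Suc l) k + rank_fps_real l k)"
    using assms by (cases "l = 0") (simp_all add: rank_fps_0_left)
  then have "fps_X ^ Suc l * ((\<Sum>i=1..Suc l. rank_fps_real i k) + (\<Sum>i=1..<Suc l. rank_fps_real i k)) =
      fps_X * (fps_X ^ l * ((\<Sum>i=1..l. rank_fps_real i k) + (\<Sum>i=1..<l. rank_fps_real i k))) + fps_X ^ Suc l * (rank_fps_real (Suc l) k + rank_fps_real l k)"
    by (simp only: distrib_left power_Suc mult.assoc)
  then show ?case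
    using Suc by (simp only: rank_fps.simps(4))
qed simp

lemma rank_fps_column_nth:
  assumes "k > 0"
  shows "(\<Sum>i=1..l. rank_fps_real i k $ n) + (\<Sum>i=1..<l. rank_fps_real i k $ n) = rank_fps_real l (Suc k) $ (n + l)"
  using arg_cong[OF rank_fps_column[OF assms, of l], of "\<lambda>f. f $ (n + l)"]
  by (simp only: fps_X_power_mult_nth fps_add_nth fps_sum_nth) simp

lemma rank_fps_1_nth: "l > 0 \<Longrightarrow> rank_fps_real l 1 $ n = (if n = l then 2 else 0)"
proof (induction l arbitrary: n rule: nat_induct_non_zero)
  case 1
  have "rank_fps_real 1 1 = fps_X * 2" by simp
  then show ?case by (auto simp: fps_X_mult_nth fps_numeral_nth)
next
  case (Suc l)
  have "rank_fps_real (Suc l) 1 = fps_X * rank_fps_real l 1"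
    using Suc.hyps by (simp add: rank_fps_0_right)
  then show ?case using Suc.IH by (cases n) auto
qed

text \<open>For fixed \<open>k\<close> the weak and the strict threshold form exactly the pair of
  \<open>rank_fps_column\<close>. Hence only shapes of the single rank \<open>-(m + 1)\<close>
  remain, with the size shifted by \<open>l\<close>.\<close>

lemma dyson_gf_nth_column:
  assumes "n \<le> N"
  shows "dyson_gf m $ n = (\<Sum>l=1..N. rank_fps_real l (Suc (l + m)) $ (n + l))"
proof -
  have "dyson_gf m $ n =
      (\<Sum>k=1..N+m. \<Sum>l=1..N+m. (of_bool (l + m \<le> k) + of_bool (l + m < k)) * rank_fps_real l k $ n)"
    unfolding dyson_gf_def fps_nth_Abs_fps using assms
    by (subst box_sum[of n "N + m"]) (simp, rule sum.swap)
  also have "\<dots> = (\<Sum>k=1..N+m. if k \<le> m then 0 else rank_fps_real (k - m) (Suc k) $ (n + (k - m)))"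
  proof (rule sum.cong[OF refl])
    fix k assume k: "k \<in> {1..N+m}"
    have "(\<Sum>l=1..N+m. (of_bool (l + m \<le> k) + of_bool (l + m < k)) * rank_fps_real l k $ n) =
        (\<Sum>l=1..N+m. of_bool (l + m \<le> k) * rank_fps_real l k $ n) + (\<Sum>l=1..N+m. of_bool (l + m < k) * rank_fps_real l k $ n)"
      by (simp add: sum.distrib algebra_simps)
    also have "(\<Sum>l=1..N+m. of_bool (l + m \<le> k) * rank_fps_real l k $ n) = (\<Sum>l=1..k-m. rank_fps_real l k $ n)"
      using k by (intro sum.mono_neutral_cong_right) auto
    also have "(\<Sum>l=1..N+m. of_bool (l + m < k) * rank_fps_real l k $ n) = (\<Sum>l=1..<k-m. rank_fps_real l k $ n)"
      using k by (intro sum.mono_neutral_cong_right) auto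
    finally show "(\<Sum>l=1..N+m. (of_bool (l + m \<le> k) + of_bool (l + m < k)) * rank_fps_real l k $ n) =
        (if k \<le> m then 0 else rank_fps_real (k - m) (Suc k) $ (n + (k - m)))"
      using k rank_fps_column_nth[where k = k and l = "k - m" and n = n] by simp
  qed
  also have "\<dots> = (\<Sum>l=1..N. rank_fps_real l (Suc (l + m)) $ (n + l))"
    by (rule sum.reindex_bij_witness_not_neutral[of "{1..m}" "{}" _ "\<lambda>l. l + m" "\<lambda>k. k - m"]) auto
  finally show ?thesis .
qed

text \<open>Conjugation turns the shapes of rank \<open>-(m + 1)\<close> into shapes of rank
  \<open>m + 1\<close>. Removing the first part of these leaves the shapes below the threshold
  \<open>m + 2\<close>, i.e. twice everything minus the shapes above it, which are conjugate to
  those of \<open>dyson_gf (m + 2)\<close>.\<close>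

lemma dyson_gf_step: "dyson_gf m = fps_X ^ Suc m * (2 * overpartition_gf - dyson_gf (m + 2))"
proof (rule fps_ext)
  fix n
  have "dyson_gf m $ n = (\<Sum>l=1..Suc n. rank_fps_real (Suc (l + m)) l $ (n + l))"
    unfolding dyson_gf_nth_column[of n "Suc n", OF le_SucI[OF order_refl]]
    by (intro sum.cong refl arg_cong2[where f = fps_nth] rank_fps_sym)
  also have "\<dots> = rank_fps_real (Suc (Suc m)) 1 $ Suc n + (\<Sum>j=1..n. rank_fps_real (j + m + 2) (Suc j) $ (Suc n + j))"
    by (subst sum.atLeast_Suc_atMost, simp, subst sum.shift_bounds_cl_Suc_ivl) (simp add: add_ac del: rank_fps.simps)
  \<comment> \<open>If the shape has a single part, nothing is left after its removal. This is the
    constant term of \<open>2 * overpartition_gf\<close>.\<close>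
  also have "rank_fps_real (Suc (Suc m)) 1 $ Suc n = (if n = Suc m then 2 else 0)"
    by (subst rank_fps_1_nth) auto
  also have "(\<Sum>j=1..n. rank_fps_real (j + m + 2) (Suc j) $ (Suc n + j)) =
      (if n < Suc m then 0 else \<Sum>j=1..n. (\<Sum>i=1..j+m+2. rank_fps_real i j $ (n - Suc m)) + (\<Sum>i=1..<j+m+2. rank_fps_real i j $ (n - Suc m)))"
  proof (cases "n < Suc m")
    case True
    then show ?thesis by (auto intro!: sum.neutral rank_fps_nth_eq_0_left simp del: rank_fps.simps)
  next
    case False
    then have "rank_fps_real (j + m + 2) (Suc j) $ (Suc n + j) =
      (\<Sum>i=1..j+m+2. rank_fps_real i j $ (n - Suc m)) + (\<Sum>i=1..<j+m+2. rank_fps_real i j $ (n - Suc m))" if "j \<ge> 1" for j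
      using rank_fps_column_nth[where k = j and l = "j + m + 2" and n = "n - Suc m"] that by (simp add: add_ac del: rank_fps.simps)
    then show ?thesis using False by (auto intro!: sum.cong)
  qed
  finally have 1: "dyson_gf m $ n = (if n = Suc m then 2 else 0) +
      (if n < Suc m then 0 else \<Sum>j=1..n. (\<Sum>i=1..j+m+2. rank_fps_real i j $ (n - Suc m)) + (\<Sum>i=1..<j+m+2. rank_fps_real i j $ (n - Suc m)))" .
  show "dyson_gf m $ n = (fps_X ^ Suc m * (2 * overpartition_gf - dyson_gf (m + 2))) $ n"
  proof (cases "n < Suc m")
    case True
    then show ?thesis using 1 by (simp add: fps_X_power_mult_nth del: power_Suc)
  next
    case False
    define d where "d = n - Suc m"
    have d: "d \<le> n" by (simp add: d_def)
    define M where "M = n + m + 2"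
    have dM: "d \<le> M" by (simp add: M_def d_def)
    have c: "(\<Sum>i=1..j+m+2. rank_fps_real i j $ d) + (\<Sum>i=1..<j+m+2. rank_fps_real i j $ d) =
        (\<Sum>i=1..M. (2 - (of_bool (j + (m + 2) \<le> i) + of_bool (j + (m + 2) < i))) * rank_fps_real i j $ d)"
      if "j \<le> n" for j
    proof -
      have "(\<Sum>i=1..j+m+2. rank_fps_real i j $ d) = (\<Sum>i=1..M. (1 - of_bool (j + (m + 2) < i)) * rank_fps_real i j $ d)"
        using that by (intro sum.mono_neutral_cong_left) (auto simp: M_def)
      moreover have "(\<Sum>i=1..<j+m+2. rank_fps_real i j $ d) = (\<Sum>i=1..M. (1 - of_bool (j + (m + 2) \<le> i)) * rank_fps_real i j $ d)"
        using that by (intro sum.mono_neutral_cong_left) (auto simp: M_def)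
      ultimately show ?thesis
        by (simp add: sum.distrib[symmetric] algebra_simps)
    qed
    have "(\<Sum>j=1..n. (\<Sum>i=1..j+m+2. rank_fps_real i j $ d) + (\<Sum>i=1..<j+m+2. rank_fps_real i j $ d)) =
        (\<Sum>j=1..M. \<Sum>i=1..M. (2 - (of_bool (j + (m + 2) \<le> i) + of_bool (j + (m + 2) < i))) * rank_fps_real i j $ d)"
    proof -
      have "(\<Sum>j=1..n. (\<Sum>i=1..j+m+2. rank_fps_real i j $ d) + (\<Sum>i=1..<j+m+2. rank_fps_real i j $ d)) =
          (\<Sum>j=1..n. \<Sum>i=1..M. (2 - (of_bool (j + (m + 2) \<le> i) + of_bool (j + (m + 2) < i))) * rank_fps_real i j $ d)"
        by (intro sum.cong refl c) auto
      also have "\<dots> = (\<Sum>j=1..M. \<Sum>i=1..M. (2 - (of_bool (j + (m + 2) \<le> i) + of_bool (j + (m + 2) < i))) * rank_fps_real i j $ d)"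
        using d by (intro sum.mono_neutral_left) (auto simp: M_def rank_fps_nth_eq_0_right intro!: sum.neutral)
      finally show ?thesis .
    qed
    also have "\<dots> = (\<Sum>j=1..M. \<Sum>i=1..M. (2 - (of_bool (j + (m + 2) \<le> i) + of_bool (j + (m + 2) < i))) * rank_fps_real j i $ d)"
      by (intro sum.cong refl arg_cong2[where f = "(*)"] arg_cong2[where f = fps_nth] rank_fps_sym)
    also have "\<dots> = 2 * (\<Sum>j=1..M. \<Sum>i=1..M. 1 * rank_fps_real j i $ d)
        - (\<Sum>j=1..M. \<Sum>i=1..M. (of_bool (j + (m + 2) \<le> i) + of_bool (j + (m + 2) < i)) * rank_fps_real j i $ d)"
      by (simp add: left_diff_distrib sum_subtractf sum_distrib_left)
    also have "\<dots> = 2 * (\<Sum>j=1..d. \<Sum>i=1..d. 1 * rank_fps_real j i $ d) - dyson_gf (m + 2) $ d"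
      unfolding box_sum[OF dM, symmetric] dyson_gf_def fps_nth_Abs_fps ..
    finally show ?thesis
      using 1 False
      by (auto simp: fps_X_power_mult_nth overpartition_gf_def d_def numeral_fps_const simp del: power_Suc)
  qed
qed

text \<open>Shift the summation index: \<open>(k+1)^2 + m*(k+1) = (m+1) + k^2 + (m+2)*k\<close>.
  This is the same recurrence as in \<open>dyson_gf_step\<close>, without the factor
  \<open>overpartition_gf\<close>.\<close>

lemma partial_theta_step: "partial_theta m = fps_X ^ Suc m * (2 - partial_theta (m + 2))"
proof (rule fps_ext)
  fix n
  define f :: "nat \<Rightarrow> real" where "f k = (if k\<^sup>2 + m * k = n then 2 * (-1) ^ (k + 1) else 0)" for k
  have "partial_theta m $ n = (\<Sum>k=1..Suc n. f k)"
    by (simp add: partial_theta_def f_def power2_eq_square)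
  also have "\<dots> = f 1 + (\<Sum>k=1..n. f (Suc k))"
    by (subst sum.atLeast_Suc_atMost, simp, subst sum.shift_bounds_cl_Suc_ivl) simp
  also have "f 1 = (if n = Suc m then 2 else 0)" by (auto simp: f_def)
  also have "(\<Sum>k=1..n. f (Suc k)) = (if n < Suc m then 0 else - (partial_theta (m + 2) $ (n - Suc m)))"
  proof (cases "n < Suc m")
    case True
    then show ?thesis by (auto intro!: sum.neutral simp: f_def power2_eq_square)
  next
    case False
    have "- (partial_theta (m + 2) $ (n - Suc m)) =
        (\<Sum>k=1..n-Suc m. if k\<^sup>2 + (m + 2) * k = n - Suc m then 2 * (-1) ^ k else 0)"
      unfolding partial_theta_def fps_nth_Abs_fps sum_negf[symmetric] by (intro sum.cong) auto
    also have "\<dots> = (\<Sum>k=1..n. f (Suc k))"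
      using False by (intro sum.mono_neutral_cong_left)
        (auto simp: f_def power2_eq_square algebra_simps)
    finally show ?thesis using False by simp
  qed
  finally show "partial_theta m $ n = (fps_X ^ Suc m * (2 - partial_theta (m + 2))) $ n"
    by (auto simp: fps_X_power_mult_nth fps_numeral_nth simp del: power_Suc)
qed

text \<open>The difference of the two sides satisfies the homogeneous recurrence, so it is divisible
  by arbitrarily high powers of \<open>X\<close>.\<close>

lemma dyson_gf_eq: "dyson_gf m = overpartition_gf * partial_theta m"
proof -
  define D where "D m = dyson_gf m - overpartition_gf * partial_theta m" for m
  have step: "D m = - (fps_X ^ Suc m * D (m + 2))" for m
    unfolding D_def by (subst dyson_gf_step, subst partial_theta_step) (simp add: algebra_simps)
  have "D m $ n = 0" for m n
  proof (induction n arbitrary: m rule: less_induct)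
    case (less n)
    then show ?case
      by (subst step) (simp add: fps_X_power_mult_nth del: power_Suc)
  qed
  then have "D m = 0" by (simp add: fps_ext)
  then show ?thesis by (simp add: D_def)
qed

text \<open>By conjugation negative ranks are as frequent as positive ones, so the weak and the
  strict half together count every nonempty overpartition once.\<close>

lemma dyson_gf_0: "dyson_gf 0 = overpartition_gf - 1"
proof (rule fps_ext)
  fix n
  have "dyson_gf 0 $ n = (\<Sum>l=1..n. \<Sum>k=1..n. of_bool (l \<le> k) * rank_fps_real l k $ n) +
      (\<Sum>l=1..n. \<Sum>k=1..n. of_bool (l < k) * rank_fps_real l k $ n)"
    by (simp add: dyson_gf_def sum.distrib algebra_simps)
  also have "(\<Sum>l=1..n. \<Sum>k=1..n. of_bool (l < k) * rank_fps_real l k $ n) = (\<Sum>l=1..n. \<Sum>k=1..n. of_bool (k < l) * rank_fps_real l k $ n)"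
    by (rule box_sum_swap)
  also have "(\<Sum>l=1..n. \<Sum>k=1..n. of_bool (l \<le> k) * rank_fps_real l k $ n) + \<dots> = (\<Sum>l=1..n. \<Sum>k=1..n. rank_fps_real l k $ n)"
    unfolding sum.distrib[symmetric] by (intro sum.cong refl) auto
  finally show "dyson_gf 0 $ n = (overpartition_gf - 1) $ n"
    by (simp add: overpartition_gf_def)
qed

text \<open>The classical fact that overpartitions are generated by
  \<open>1 / \<theta>(-q)\<close>.\<close>

lemma overpartition_gf_mult: "overpartition_gf * (1 - partial_theta 0) = 1"
  using dyson_gf_eq[of 0] dyson_gf_0 by (simp add: algebra_simps)

lemma partial_theta_mult_dyson_gf: "(1 - partial_theta 0) * dyson_gf m = partial_theta m"
  unfolding dyson_gf_eq using overpartition_gf_mult by (simp add: mult_ac)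

lemma dyson_gf_nth_eq_0: "n < m \<Longrightarrow> dyson_gf m $ n = 0"
  by (subst dyson_gf_step) (simp add: fps_X_power_mult_nth del: power_Suc)

section \<open>From rank thresholds to the parity of the rank\<close>

lemma alternating_sum: "2 * (\<Sum>m=1..<r. (-1) ^ m * real m) + (-1) ^ r * real r = ((-1) ^ r - 1) / 2"
proof (induction r)
  case (Suc r)
  then show ?case by (cases "r = 0") (auto simp: algebra_simps)
qed simp

text \<open>The weights \<open>(-1)^m * m\<close> convert the threshold conditions on
  \<open>r = k - l\<close> into the parity of \<open>r\<close>.\<close>

lemma alternating_weight:
  assumes "l \<le> n" "k \<le> n" "l < k"
  shows "(\<Sum>m=1..n. (-1) ^ m * real m * (of_bool (l + m \<le> k) + of_bool (l + m < k))) =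
         ((-1) ^ (l + k) - 1) / 2"
proof -
  define r where "r = k - l"
  have k: "k = l + r" and r: "r \<ge> 1" "r \<le> n" using assms by (auto simp: r_def)
  have "(\<Sum>m=1..n. (-1) ^ m * real m * (of_bool (l + m \<le> k) + of_bool (l + m < k))) =
      (\<Sum>m=1..n. (-1) ^ m * real m * of_bool (m \<le> r)) + (\<Sum>m=1..n. (-1) ^ m * real m * of_bool (m < r))"
    by (simp add: k sum.distrib algebra_simps)
  also have "(\<Sum>m=1..n. (-1) ^ m * real m * of_bool (m \<le> r)) = (\<Sum>m=1..r. (-1) ^ m * real m)"
    using r by (intro sum.mono_neutral_cong_right) auto
  also have "\<dots> = (\<Sum>m=1..<r. (-1) ^ m * real m) + (-1) ^ r * real r"
    using r by (simp add: sum.last_plus flip: atLeastLessThanSuc_atLeastAtMost)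
  also have "(\<Sum>m=1..n. (-1) ^ m * real m * of_bool (m < r)) = (\<Sum>m=1..<r. (-1) ^ m * real m)"
    using r by (intro sum.mono_neutral_cong_right) auto
  finally show ?thesis using alternating_sum[of r]
    by (simp add: k power_add power_mult_distrib[symmetric])
qed

text \<open>The right side weights only shapes with \<open>l \<le> k\<close>. By conjugation its
  weight \<open>w\<close> matters only through \<open>w l k + w k l\<close>, and this equals
  \<open>2 * (-1)^(l + k)\<close>.\<close>

lemma alternating_rank_gf_eq:
  "alternating_rank_gf = 1 + dyson_gf 0 + 4 * Abs_fps (\<lambda>n. \<Sum>m=1..n. (-1) ^ m * real m * dyson_gf m $ n)"
proof (rule fps_ext)
  fix n
  define w :: "nat \<Rightarrow> nat \<Rightarrow> real" where "w l k = of_bool (l \<le> k) + of_bool (l < k) +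
      4 * (\<Sum>m=1..n. (-1) ^ m * real m * (of_bool (l + m \<le> k) + of_bool (l + m < k)))" for l k
  have w: "w l k + w k l = 2 * (-1) ^ (l + k)" if "l \<le> n" "k \<le> n" for l k
  proof (cases l k rule: linorder_cases)
    case less
    then show ?thesis using alternating_weight[OF that less]
      by (simp add: w_def)
  next
    case equal
    then show ?thesis by (simp add: w_def)
  next
    case greater
    then show ?thesis using alternating_weight[OF that(2,1) greater]
      by (simp add: w_def add.commute)
  qed
  have "2 * (\<Sum>l=1..n. \<Sum>k=1..n. (-1) ^ (l + k) * rank_fps_real l k $ n) = (\<Sum>l=1..n. \<Sum>k=1..n. (w l k + w k l) * rank_fps_real l k $ n)"
    unfolding sum_distrib_left by (intro sum.cong refl) (simp add: w)
  also have "\<dots> = 2 * (\<Sum>l=1..n. \<Sum>k=1..n. w l k * rank_fps_real l k $ n)"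
    using box_sum_swap[of w n n] by (simp add: distrib_right sum.distrib)
  also have "(\<Sum>l=1..n. \<Sum>k=1..n. w l k * rank_fps_real l k $ n) =
      dyson_gf 0 $ n + 4 * (\<Sum>m=1..n. (-1) ^ m * real m * dyson_gf m $ n)"
  proof -
    define f where "f l k m = (-1) ^ m * real m * ((of_bool (l + m \<le> k) + of_bool (l + m < k)) * rank_fps_real l k $ n)" for l k m
    have w': "w l k * rank_fps_real l k $ n = (of_bool (l + 0 \<le> k) + of_bool (l + 0 < k)) * rank_fps_real l k $ n + 4 * (\<Sum>m=1..n. f l k m)" for l k
      by (simp add: w_def f_def distrib_right sum_distrib_right mult.assoc)
    have "(\<Sum>l=1..n. \<Sum>k=1..n. w l k * rank_fps_real l k $ n) = dyson_gf 0 $ n + 4 * (\<Sum>l=1..n. \<Sum>k=1..n. \<Sum>m=1..n. f l k m)"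
      unfolding w' dyson_gf_def fps_nth_Abs_fps sum.distrib sum_distrib_left ..
    also have "(\<Sum>l=1..n. \<Sum>k=1..n. \<Sum>m=1..n. f l k m) = (\<Sum>l=1..n. \<Sum>m=1..n. \<Sum>k=1..n. f l k m)"
      by (intro sum.cong refl sum.swap)
    also have "\<dots> = (\<Sum>m=1..n. \<Sum>l=1..n. \<Sum>k=1..n. f l k m)"
      by (rule sum.swap)
    also have "\<dots> = (\<Sum>m=1..n. (-1) ^ m * real m * dyson_gf m $ n)"
      unfolding dyson_gf_def fps_nth_Abs_fps sum_distrib_left f_def ..
    finally show ?thesis .
  qed
  finally show "alternating_rank_gf $ n =
      (1 + dyson_gf 0 + 4 * Abs_fps (\<lambda>n. \<Sum>m=1..n. (-1) ^ m * real m * dyson_gf m $ n)) $ n"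
    by (simp add: alternating_rank_gf_def numeral_fps_const)
qed

text \<open>Multiplication by \<open>\<theta>(-q)\<close> replaces each \<open>dyson_gf m\<close> by
  \<open>partial_theta m\<close>. As \<open>dyson_gf m\<close> has order at least \<open>m\<close>,
  the sum over \<open>m\<close> stops at \<open>n\<close>.\<close>

lemma partial_theta_mult_alternating_rank_gf:
  "((1 - partial_theta 0) * alternating_rank_gf) $ n =
     (if n = 0 then 1 else 0) + 4 * (\<Sum>m=1..n. (-1) ^ m * real m * partial_theta m $ n)"
proof -
  define Z where "Z = Abs_fps (\<lambda>n. \<Sum>m=1..n. (-1) ^ m * real m * dyson_gf m $ n)"
  have "(f * Z) $ n = (\<Sum>m=1..n. (-1) ^ m * real m * (f * dyson_gf m) $ n)" for f
  proof -
    have "Z $ i = (\<Sum>m=1..n. (-1) ^ m * real m * dyson_gf m $ i)" if "i \<le> n" for i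
      unfolding Z_def fps_nth_Abs_fps
      using that by (intro sum.mono_neutral_left) (auto simp: dyson_gf_nth_eq_0)
    then have "(f * Z) $ n = (\<Sum>i=0..n. \<Sum>m=1..n. (-1) ^ m * real m * (f $ i * dyson_gf m $ (n - i)))"
      unfolding fps_mult_nth by (intro sum.cong refl) (simp add: sum_distrib_left algebra_simps)
    also have "\<dots> = (\<Sum>m=1..n. (-1) ^ m * real m * (f * dyson_gf m) $ n)"
      unfolding fps_mult_nth sum_distrib_left by (rule sum.swap)
    finally show ?thesis .
  qed
  moreover have "(1 - partial_theta 0) * alternating_rank_gf = 1 + 4 * ((1 - partial_theta 0) * Z)"
  proof -
    have "(1 - partial_theta 0) * alternating_rank_gf =
       (1 - partial_theta 0) + (1 - partial_theta 0) * dyson_gf 0 + 4 * ((1 - partial_theta 0) * Z)"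
      by (simp add: alternating_rank_gf_eq Z_def algebra_simps)
    then show ?thesis by (simp add: partial_theta_mult_dyson_gf)
  qed
  ultimately show ?thesis
    by (simp add: partial_theta_mult_dyson_gf numeral_fps_const)
qed

section \<open>A class number relation\<close>

lemma summable_on_int:
  fixes f :: "int \<Rightarrow> real"
  assumes "(\<lambda>n. f (int n)) summable_on UNIV" "(\<lambda>n. f (- int n)) summable_on UNIV"
  shows "f summable_on UNIV"
proof -
  have "f summable_on range int"
    using assms(1) by (subst summable_on_reindex) (auto simp: o_def)
  moreover have "f summable_on range (\<lambda>n. - int n)"
    using assms(2) by (subst summable_on_reindex) (auto simp: o_def inj_on_def)
  moreover have "range int \<union> range (\<lambda>n. - int n) = UNIV"
    by (auto simp: image_iff) (metis int_cases2)
  ultimately show ?thesis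
    using summable_on_union by metis
qed

lemma summable_on_abs_le:
  fixes f g :: "'a \<Rightarrow> real"
  assumes "g summable_on A" "\<And>x. x \<in> A \<Longrightarrow> \<bar>f x\<bar> \<le> g x"
  shows "f summable_on A"
proof (rule abs_summable_summable)
  show "(\<lambda>x. norm (f x)) summable_on A"
    using assms by (intro abs_summable_on_comparison_test'[of g A f]) auto
qed

lemma has_sum_minus:
  fixes f g :: "'a \<Rightarrow> real"
  assumes "(f has_sum a) A" "(g has_sum b) A"
  shows "((\<lambda>x. f x - g x) has_sum (a - b)) A"
  using has_sum_add[OF assms(1) has_sum_uminusI[OF assms(2)]] by simp

lemma has_sum_finite_sum:
  fixes f :: "'i \<Rightarrow> 'a \<Rightarrow> real"
  assumes "finite T" "\<And>t. t \<in> T \<Longrightarrow> (f t has_sum g t) A"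
  shows "((\<lambda>x. \<Sum>t\<in>T. f t x) has_sum (\<Sum>t\<in>T. g t)) A"
  using assms by (induction T rule: finite_induct) (auto intro!: has_sum_add)

lemma summable_on_product:
  fixes f :: "'a \<Rightarrow> real" and g :: "'b \<Rightarrow> real"
  assumes "f summable_on A" "g summable_on B" "\<And>x. x \<in> A \<Longrightarrow> f x \<ge> 0" "\<And>y. y \<in> B \<Longrightarrow> g y \<ge> 0"
  shows "(\<lambda>(x, y). f x * g y) summable_on A \<times> B"
proof (rule summable_on_SigmaI)
  show "((\<lambda>y. case (x, y) of (x, y) \<Rightarrow> f x * g y) has_sum f x * infsum g B) B" for x
    using assms by (auto intro!: has_sum_cmult_right)
  show "(\<lambda>x. f x * infsum g B) summable_on A"
    using assms by (intro summable_on_cmult_left)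
qed (use assms in auto)

text \<open>Grouping a summable family by its exponent. The fibres may be infinite, so their
  summability is recorded as well instead of a finiteness proof.\<close>

lemma has_sum_powser:
  fixes w :: "'i \<Rightarrow> real" and q :: real
  assumes "((\<lambda>i. w i * q ^ e i) has_sum S) I" "q \<noteq> 0"
  shows "((\<lambda>n. infsum w {i\<in>I. e i = n} * q ^ n) has_sum S) UNIV"
    and "w summable_on {i\<in>I. e i = n}"
proof -
  have fiber: "(\<lambda>i. w i * q ^ n) summable_on {i\<in>I. e i = n}" for n
  proof -
    have "(\<lambda>i. w i * q ^ e i) summable_on {i\<in>I. e i = n}"
      by (rule summable_on_subset[OF has_sum_imp_summable[OF assms(1)]]) auto
    then show ?thesis by (rule summable_on_cong[THEN iffD1, rotated]) auto
  qed
  then have w: "w summable_on {i\<in>I. e i = n}" for n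
    using assms(2) by (subst (asm) summable_on_cmult_left') auto
  show "w summable_on {i\<in>I. e i = n}" by (rule w)
  have "((\<lambda>(n, i). w i * q ^ n) has_sum S) (SIGMA n:UNIV. {i\<in>I. e i = n})"
    using assms(1)
    by (subst (asm) has_sum_reindex_bij_witness[of I snd "\<lambda>i. (e i, i)" _ "\<lambda>(n, i). w i * q ^ n"]) auto
  then show "((\<lambda>n. infsum w {i\<in>I. e i = n} * q ^ n) has_sum S) UNIV"
    by (rule has_sum_SigmaD) (use w in \<open>auto intro!: has_sum_cmult_left\<close>)
qed

lemma has_sum_linear_geometric:
  fixes x :: real
  assumes "0 \<le> x" "x < 1"
  shows "((\<lambda>i. real i * x ^ i) has_sum (x / (1 - x)\<^sup>2)) {1..}"
proof -
  have "((\<lambda>n. real (Suc n) * x ^ n) has_sum (1 / (1 - x)\<^sup>2)) UNIV"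
    using geometric_deriv_sums[of x] assms by (intro sums_nonneg_imp_has_sum) simp_all
  then have "((\<lambda>n. x * (real (Suc n) * x ^ n)) has_sum (x * (1 / (1 - x)\<^sup>2))) UNIV"
    by (rule has_sum_cmult_right)
  then show ?thesis
    by (subst has_sum_reindex_bij_witness[of _ Suc "\<lambda>i. i - 1" UNIV
          "\<lambda>n. x * (real (Suc n) * x ^ n)"]) (auto simp: Suc_diff_1 power_eq_if)
qed

text \<open>
  With \<open>q = exp(-h)\<close> this is \<open>coth(jh)\<close>, continued by 0 to the pole at \<open>j = 0\<close> so that it
  stays an odd function of \<open>j\<close>.
\<close>

definition qcoth :: "real \<Rightarrow> int \<Rightarrow> real" where
  "qcoth q j = (if j = 0 then 0 else (1 + q powi (2 * j)) / (1 - q powi (2 * j)))"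

definition qtheta :: "real \<Rightarrow> real" where
  "qtheta q = (\<Sum>\<^sub>\<infinity>k::int. q powi (k\<^sup>2))"

text \<open>
  The half-open range is the symmetric range \<open>\<bar>t\<bar> \<le> s\<close> with both end points counted half.
\<close>

definition qpartial :: "real \<Rightarrow> int \<Rightarrow> real" where
  "qpartial q s = (\<Sum>t\<in>{-s..<s}. q powi (s\<^sup>2 - t\<^sup>2))"

section \<open>The function \<open>qcoth\<close> and its product formula with the theta
  function\<close>

lemma qcoth_addition_aux:
  fixes x y :: real
  assumes "x \<noteq> 1" "y \<noteq> 1" "x * y \<noteq> 1"
  shows "(1 + x) / (1 - x) * ((1 + y) / (1 - y)) =
    (1 + x * y) / (1 - x * y) * ((1 + x) / (1 - x) + (1 + y) / (1 - y)) - 1"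
proof -
  define X Y Z where "X = 1 - x" and "Y = 1 - y" and "Z = 1 - x * y"
  have nz: "X \<noteq> 0" "Y \<noteq> 0" "Z \<noteq> 0" using assms by (auto simp: X_def Y_def Z_def)
  define A B C where "A = (1 + x) / X" and "B = (1 + y) / Y" and "C = (1 + x * y) / Z"
  have ABC: "A * X = 1 + x" "B * Y = 1 + y" "C * Z = 1 + x * y"
    using nz by (simp_all add: A_def B_def C_def)
  have "(A * B - (C * (A + B) - 1)) * (X * Y * Z) =
      (A * X) * (B * Y) * Z - (C * Z) * ((A * X) * Y + (B * Y) * X) + X * Y * Z"
    by (simp add: algebra_simps)
  also have "\<dots> = 0"
    unfolding ABC by (simp add: X_def Y_def Z_def algebra_simps)
  finally have "A * B - (C * (A + B) - 1) = 0"
    using nz by simp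
  then show ?thesis by (simp add: A_def B_def C_def X_def Y_def Z_def)
qed

context
  fixes q :: real
  assumes q: "0 < q" "q < 1"
begin

lemma q_powi_add: "q powi (a + b) = q powi a * q powi b"
  using q by (simp add: power_int_add)

lemma q_powi_mono: "a \<le> b \<Longrightarrow> q powi b \<le> q powi a"
  using q by (intro power_int_decreasing) auto

lemma q_powi_neq_1:
  assumes "j \<noteq> 0"
  shows "q powi j \<noteq> 1"
proof (cases "j > 0")
  case True
  then show ?thesis using q_powi_mono[of 1 j] q by simp
next
  case False
  then have "1 / q \<le> q powi j"
    using assms q_powi_mono[of j "-1"] by (simp add: power_int_minus divide_inverse)
  moreover have "1 / q > 1" using q by simp
  ultimately show ?thesis by simp
qed

lemma qcoth_0 [simp]: "qcoth q 0 = 0"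
  by (simp add: qcoth_def)

lemma qcoth_minus [simp]: "qcoth q (- j) = - qcoth q j"
proof (cases "j = 0")
  case False
  define x where "x = q powi (2 * j)"
  have "x \<noteq> 1" "x > 0" using q_powi_neq_1[of "2 * j"] False q by (auto simp: x_def)
  moreover have "q powi (2 * (-j)) = inverse x" by (simp add: x_def power_int_minus)
  ultimately show ?thesis using False
    by (simp add: qcoth_def x_def[symmetric]) (simp add: field_simps)
qed simp

text \<open>The addition theorem of the hyperbolic cotangent. It fails at the pole, where
  \<open>qcoth\<close> has the artificial value 0; hence the three hypotheses.\<close>

lemma qcoth_mult:
  assumes "a \<noteq> 0" "b \<noteq> 0" "a + b \<noteq> 0"
  shows "qcoth q a * qcoth q b = qcoth q (a + b) * (qcoth q a + qcoth q b) - 1"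
proof -
  define x y where "x = q powi (2 * a)" and "y = q powi (2 * b)"
  have xy: "q powi (2 * (a + b)) = x * y" by (simp add: x_def y_def distrib_left q_powi_add)
  have "x \<noteq> 1" "y \<noteq> 1" "x * y \<noteq> 1"
    using assms unfolding xy[symmetric] unfolding x_def y_def by (intro q_powi_neq_1; simp)+
  then have "(1 + x) / (1 - x) * ((1 + y) / (1 - y)) =
      (1 + x * y) / (1 - x * y) * ((1 + x) / (1 - x) + (1 + y) / (1 - y)) - 1"
    by (rule qcoth_addition_aux)
  moreover have "qcoth q a = (1 + x) / (1 - x)" "qcoth q b = (1 + y) / (1 - y)"
    "qcoth q (a + b) = (1 + x * y) / (1 - x * y)"
    using assms by (simp_all only: qcoth_def xy if_False x_def y_def)
  ultimately show ?thesis by simp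
qed

lemma qcoth_eq: "j > 0 \<Longrightarrow> qcoth q j = 1 + 2 * (q powi (2 * j) / (1 - q powi (2 * j)))"
  using q_powi_neq_1[of "2 * j"] by (simp add: qcoth_def field_simps)

text \<open>The exponentially fast approach of \<open>qcoth\<close> to 1 makes the double series
  below converge absolutely.\<close>

lemma qcoth_bounds:
  assumes "j > 0"
  shows "1 \<le> qcoth q j" "qcoth q j \<le> 1 + 2 / (1 - q) * q powi (2 * j)" "qcoth q j \<le> 1 + 2 / (1 - q)"
proof -
  have x: "q powi (2 * j) \<le> q" "0 < q powi (2 * j)"
    using q_powi_mono[of 1 "2 * j"] assms q by simp_all
  show "1 \<le> qcoth q j"
    using x q assms by (simp add: qcoth_eq)
  show *: "qcoth q j \<le> 1 + 2 / (1 - q) * q powi (2 * j)"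
    using x q assms by (simp add: qcoth_eq frac_le)
  have "2 / (1 - q) * q powi (2 * j) \<le> 2 / (1 - q) * 1"
    using x q by (intro mult_left_mono) auto
  then show "qcoth q j \<le> 1 + 2 / (1 - q)" using * by simp
qed

lemma abs_qcoth_le: "\<bar>qcoth q j\<bar> \<le> 1 + 2 / (1 - q)"
proof (cases j "0 :: int" rule: linorder_cases)
  case less
  then show ?thesis using qcoth_bounds[of "- j"] by simp
next
  case equal
  then show ?thesis using q by simp
next
  case greater
  then show ?thesis using qcoth_bounds[of j] by simp
qed

lemma summable_powi_abs: "(\<lambda>m::int. q powi \<bar>m\<bar>) summable_on UNIV"
proof (rule summable_on_int)
  have "(\<lambda>n. q ^ n) summable_on (UNIV :: nat set)"
    using q by (simp add: summable_on_UNIV_nonneg_real_iff summable_geometric)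
  then show "(\<lambda>n. q powi \<bar>int n\<bar>) summable_on UNIV" "(\<lambda>n. q powi \<bar>- int n\<bar>) summable_on UNIV"
    by simp_all
qed

text \<open>The loss \<open>2 * \<bar>m\<bar>\<close> in the exponent comes from estimating
  \<open>qcoth q (s + m)\<close> in terms of \<open>s\<close> and \<open>m\<close> separately in
  \<open>summable_qcoth_double\<close>.\<close>

lemma summable_gauss: "(\<lambda>m::int. q powi (m\<^sup>2 - 2 * \<bar>m\<bar>)) summable_on UNIV"
proof (rule summable_on_comparison_test)
  show "(\<lambda>m. q powi (-3) * q powi \<bar>m\<bar>) summable_on UNIV"
    by (intro summable_on_cmult_right summable_powi_abs)
  fix m :: int
  have "0 \<le> (\<bar>m\<bar> - 1) * (\<bar>m\<bar> - 2)"
    by (cases "\<bar>m\<bar> \<ge> 2") (auto simp: mult_nonneg_nonneg mult_nonpos_nonpos)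
  then have "-3 + \<bar>m\<bar> \<le> m\<^sup>2 - 2 * \<bar>m\<bar>"
    by (simp add: algebra_simps power2_eq_square)
  then show "q powi (m\<^sup>2 - 2 * \<bar>m\<bar>) \<le> q powi (-3) * q powi \<bar>m\<bar>"
    unfolding q_powi_add[symmetric] by (rule q_powi_mono)
qed (use q in auto)

lemma has_sum_qtheta: "((\<lambda>k. q powi ((k + i)\<^sup>2)) has_sum qtheta q) UNIV"
proof -
  have "(\<lambda>k::int. q powi (k\<^sup>2)) summable_on UNIV"
    by (rule summable_on_comparison_test[OF summable_gauss]) (use q in \<open>auto intro: q_powi_mono\<close>)
  then have "((\<lambda>k::int. q powi (k\<^sup>2)) has_sum qtheta q) UNIV"
    unfolding qtheta_def by (rule has_sum_infsum)
  then show ?thesis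
    by (subst has_sum_reindex_bij_witness[of _ "\<lambda>k. k - i" "\<lambda>k. k + i" UNIV "\<lambda>k. q powi (k\<^sup>2)"]) auto
qed

text \<open>Shifting the index of the theta series by \<open>t\<close> gives the exponent
  \<open>j^2 + 2*t*j + s^2\<close>, so the sum over \<open>t\<close> is geometric with ratio
  \<open>q^(2*j)\<close>. For \<open>j = 0\<close> the ratio is 1 and the sum is
  \<open>2 * s * q^(s^2)\<close>, the correction on the right.\<close>

lemma qtheta_mult_qpartial:
  assumes s: "s > 0"
  shows "((\<lambda>j. qcoth q j * q powi ((j - s)\<^sup>2)) has_sum
    (qtheta q * qpartial q s - 2 * of_int s * q powi (s\<^sup>2))) UNIV"
proof -
  define F where "F j = (\<Sum>t\<in>{-s..<s}. q powi (j\<^sup>2 + 2 * t * j + s\<^sup>2))" for j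
  have "((\<lambda>j. q powi (j\<^sup>2 + 2 * t * j + s\<^sup>2)) has_sum (qtheta q * q powi (s\<^sup>2 - t\<^sup>2))) UNIV" for t
  proof -
    have "q powi (j\<^sup>2 + 2 * t * j + s\<^sup>2) = q powi ((j + t)\<^sup>2) * q powi (s\<^sup>2 - t\<^sup>2)" for j
      unfolding q_powi_add[symmetric] by (simp add: power2_eq_square algebra_simps)
    then show ?thesis
      using has_sum_cmult_left[OF has_sum_qtheta] by simp
  qed
  then have F1: "(F has_sum (qtheta q * qpartial q s)) UNIV"
    unfolding F_def qpartial_def sum_distrib_left by (intro has_sum_finite_sum) auto
  define H where "H = (\<Sum>\<^sub>\<infinity>j. qcoth q j * q powi ((j - s)\<^sup>2))"
  have H: "((\<lambda>j. qcoth q j * q powi ((j - s)\<^sup>2)) has_sum H) UNIV"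
    unfolding H_def
  proof (rule has_sum_infsum[OF summable_on_abs_le])
    show "(\<lambda>j. (1 + 2 / (1 - q)) * q powi ((j - s)\<^sup>2)) summable_on UNIV"
      using has_sum_imp_summable[OF has_sum_qtheta[of "- s"]] by (intro summable_on_cmult_right) simp
    show "\<bar>qcoth q j * q powi ((j - s)\<^sup>2)\<bar> \<le> (1 + 2 / (1 - q)) * q powi ((j - s)\<^sup>2)" for j
      using abs_qcoth_le[of j] q by (simp add: abs_mult mult_right_mono)
  qed
  have H': "((\<lambda>j. qcoth q j * q powi ((j + s)\<^sup>2)) has_sum (- H)) UNIV"
  proof -
    have "((\<lambda>j. - (qcoth q j * q powi ((j - s)\<^sup>2))) has_sum (- H)) UNIV"
      using H by (rule has_sum_uminusI)
    moreover have "(- j - s)\<^sup>2 = (j + s)\<^sup>2" for j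
      by (simp add: power2_eq_square algebra_simps)
    ultimately show ?thesis
      by (subst has_sum_reindex_bij_witness[of _ uminus uminus UNIV "\<lambda>j. - (qcoth q j * q powi ((j - s)\<^sup>2))"]) auto
  qed
  \<comment> \<open>The geometric sum, rewritten with
    \<open>1 / (1 - q^(2*j)) = (1 + qcoth q j) / 2\<close>. The two pure theta sums cancel, and the
    two \<open>qcoth\<close> sums agree up to sign because \<open>qcoth\<close> is odd, so the total
    is \<open>H\<close>.\<close>
  define G where "G j = (q powi ((j + (-s))\<^sup>2) + qcoth q j * q powi ((j - s)\<^sup>2)
      - (q powi ((j + s)\<^sup>2) + qcoth q j * q powi ((j + s)\<^sup>2))) / 2" for j
  have G: "(G has_sum ((qtheta q + H - (qtheta q + (- H))) / 2)) UNIV"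
    unfolding G_def
    by (intro has_sum_divide_const has_sum_minus has_sum_add has_sum_qtheta H H')
  have FG: "F j = G j + (if j = 0 then 2 * of_int s * q powi (s\<^sup>2) else 0)" for j
  proof (cases "j = 0")
    case True
    then show ?thesis using s by (simp add: F_def G_def)
  next
    case False
    define x where "x = q powi (2 * j)"
    have x: "x \<noteq> 1" "x > 0" using q_powi_neq_1[of "2 * j"] False q by (auto simp: x_def)
    define y where "y = q powi (j\<^sup>2 - 2 * s * j + s\<^sup>2)"
    have "F j = (\<Sum>i<nat (2 * s). q powi (j\<^sup>2 + 2 * (int i - s) * j + s\<^sup>2))"
      unfolding F_def
      by (rule sum.reindex_bij_witness[of _ "\<lambda>i. int i - s" "\<lambda>t. nat (t + s)"]) auto
    also have "\<dots> = (\<Sum>i<nat (2 * s). y * x ^ i)"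
    proof (rule sum.cong)
      fix i
      have "x ^ i = q powi (2 * j * int i)"
        unfolding x_def power_int_mult by simp
      then show "q powi (j\<^sup>2 + 2 * (int i - s) * j + s\<^sup>2) = y * x ^ i"
        unfolding y_def by (simp add: q_powi_add[symmetric]) (simp add: algebra_simps)
    qed simp
    also have "\<dots> = y * ((1 - x ^ nat (2 * s)) / (1 - x))"
      using x by (simp add: sum_distrib_left[symmetric] sum_gp_strict)
    also have "\<dots> = (y - y * x ^ nat (2 * s)) / (1 - x)"
      by (simp add: algebra_simps)
    also have "y = q powi ((j - s)\<^sup>2)"
      by (simp add: y_def power2_eq_square algebra_simps)
    also have "q powi ((j - s)\<^sup>2) * x ^ nat (2 * s) = q powi ((j + s)\<^sup>2)"
    proof -
      have "int (nat (2 * s)) = 2 * s" using s by simp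
      then have "x ^ nat (2 * s) = q powi (2 * j * (2 * s))"
        by (metis power_int_mult power_int_of_nat x_def)
      then show ?thesis
        by (simp add: q_powi_add[symmetric]) (simp add: power2_eq_square algebra_simps)
    qed
    also have "(q powi ((j - s)\<^sup>2) - q powi ((j + s)\<^sup>2)) / (1 - x) = G j"
    proof -
      have "(1 + qcoth q j) / 2 = 1 / (1 - x)"
      proof -
        have "qcoth q j = (1 + x) / (1 - x)"
          using False by (simp add: qcoth_def x_def)
        then show ?thesis using x by (simp add: field_simps)
      qed
      moreover have "G j = (1 + qcoth q j) / 2 * (q powi ((j - s)\<^sup>2) - q powi ((j + s)\<^sup>2))"
        by (simp add: G_def field_simps)
      ultimately show ?thesis by (simp only:) simp
    qed
    finally show ?thesis using False by simp
  qed
  have "((\<lambda>j. G j + (if j = 0 then 2 * of_int s * q powi (s\<^sup>2) else 0)) has_sum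
      (H + 2 * of_int s * q powi (s\<^sup>2))) UNIV"
  proof (rule has_sum_add)
    show "(G has_sum H) UNIV" using G by simp
    show "((\<lambda>j. if j = 0 then 2 * of_int s * q powi (s\<^sup>2) else 0) has_sum 2 * of_int s * q powi (s\<^sup>2)) UNIV"
      by (rule has_sum_finite_neutralI[of "{0}"]) auto
  qed
  then have "qtheta q * qpartial q s = H + 2 * of_int s * q powi (s\<^sup>2)"
    using F1 FG has_sum_unique by (metis (no_types, lifting) has_sum_cong)
  then show ?thesis using H by (simp add: algebra_simps)
qed

end

section \<open>Folding and shifting sums over integers\<close>

lemma has_sum_int_fold:
  fixes f :: "int \<Rightarrow> real"
  assumes "(f has_sum S) UNIV"
  shows "((\<lambda>m. f m + f (- m)) has_sum (S - f 0)) {1..}"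
proof -
  have summable: "f summable_on A" for A
    using summable_on_subset[OF has_sum_imp_summable[OF assms]] by simp
  define P N where "P = infsum f {1..}" and "N = infsum f {..-1}"
  have P: "(f has_sum P) {1..}" and N: "(f has_sum N) {..-1}"
    using summable by (simp_all add: P_def N_def)
  have "(f has_sum (N + (f 0 + P))) ({..-1} \<union> ({0} \<union> {1..}))"
  proof (intro has_sum_Un_disjoint P N)
    show "(f has_sum f 0) {0}" by (rule has_sum_finiteI) auto
  qed auto
  moreover have "{..-1} \<union> ({0} \<union> {1..}) = (UNIV :: int set)" by auto
  ultimately have S: "S = N + (f 0 + P)" using has_sum_unique[OF assms] by simp
  have "((\<lambda>m. f (- m)) has_sum N) {1..}"
    using N by (subst has_sum_reindex_bij_witness[of _ uminus uminus "{..-1}" f]) auto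
  from has_sum_add[OF P this] show ?thesis
    using S by (simp add: add.commute)
qed

lemma has_sum_shift_int:
  fixes f :: "int \<Rightarrow> real"
  assumes "(f has_sum S) {1..}" "m \<ge> 0"
  shows "((\<lambda>s. f (s + m)) has_sum (S - (\<Sum>i\<in>{1..m}. f i))) {1..}"
proof -
  have summable: "f summable_on {m+1..}"
    using summable_on_subset[OF has_sum_imp_summable[OF assms(1)], of "{m+1..}"] assms(2) by auto
  have "(f has_sum ((\<Sum>i\<in>{1..m}. f i) + infsum f {m+1..})) ({1..m} \<union> {m+1..})"
    using summable by (intro has_sum_Un_disjoint) auto
  moreover have "{1..m} \<union> {m+1..} = {1..}" using assms(2) by auto
  ultimately have "S = (\<Sum>i\<in>{1..m}. f i) + infsum f {m+1..}"
    using has_sum_unique[OF assms(1)] by simp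
  moreover have "((\<lambda>s. f (s + m)) has_sum infsum f {m+1..}) {1..}"
    using summable
    by (subst has_sum_reindex_bij_witness[of _ "\<lambda>s. s - m" "\<lambda>s. s + m" "{m+1..}" f]) auto
  ultimately show ?thesis by simp
qed

section \<open>Telescoping and interchange of summation\<close>

context
  fixes q :: real
  assumes q: "0 < q" "q < 1"
begin

lemma summable_powi_double: "(\<lambda>s::int. q powi (2 * s)) summable_on {1..}"
  by (rule summable_on_comparison_test[OF summable_on_subset[OF summable_powi_abs[OF q], of "{1..}"]])
    (use q in \<open>auto intro: q_powi_mono[OF q]\<close>)

text \<open>By the addition theorem the summand is
  \<open>qcoth q m * (qcoth q s - qcoth q (s + m))\<close>, which telescopes. Subtracting the limit
  1 from each \<open>qcoth\<close> makes both parts summable and produces the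
  \<open>- of_int m\<close>.\<close>

lemma has_sum_qcoth_shift:
  assumes "m \<ge> 1"
  shows "((\<lambda>s. qcoth q s * qcoth q (s + m) - 1) has_sum
     qcoth q m * ((\<Sum>i\<in>{1..m}. qcoth q i) - of_int m)) {1..}"
proof -
  have "(\<lambda>s. qcoth q s - 1) summable_on {1..}"
  proof (rule summable_on_abs_le)
    show "(\<lambda>s::int. 2 / (1 - q) * q powi (2 * s)) summable_on {1..}"
      by (intro summable_on_cmult_right summable_powi_double)
    show "\<bar>qcoth q s - 1\<bar> \<le> 2 / (1 - q) * q powi (2 * s)" if "s \<in> {1..}" for s
      using qcoth_bounds[OF q, of s] that by auto
  qed
  then obtain S where S: "((\<lambda>s. qcoth q s - 1) has_sum S) {1..}"
    by (auto simp: summable_on_def)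
  have "((\<lambda>s. (qcoth q s - 1) - (qcoth q (s + m) - 1)) has_sum
      (S - (S - (\<Sum>i\<in>{1..m}. qcoth q i - 1)))) {1..}"
    using assms by (intro has_sum_minus S has_sum_shift_int[OF S]) auto
  then have "((\<lambda>s. qcoth q s - qcoth q (s + m)) has_sum ((\<Sum>i\<in>{1..m}. qcoth q i) - of_int m)) {1..}"
    using assms by (simp add: sum_subtractf)
  then have "((\<lambda>s. qcoth q m * (qcoth q s - qcoth q (s + m))) has_sum
      qcoth q m * ((\<Sum>i\<in>{1..m}. qcoth q i) - of_int m)) {1..}"
    by (rule has_sum_cmult_right)
  moreover have "qcoth q m * (qcoth q s - qcoth q (s + m)) = qcoth q s * qcoth q (s + m) - 1"
    if "s \<in> {1..}" for s
    using qcoth_mult[OF q, of s m] that assms by (simp add: algebra_simps)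
  ultimately show ?thesis
    by (subst has_sum_cong[where g = "\<lambda>s. qcoth q m * (qcoth q s - qcoth q (s + m))"]) auto
qed

text \<open>For \<open>s < m\<close> the addition theorem applies to \<open>s + (m - s) = m\<close>.
  The term \<open>s = m\<close> meets the pole; the convention \<open>qcoth q 0 = 0\<close> makes it
  \<open>-1\<close>.\<close>

lemma sum_qcoth_reflect:
  assumes "m \<ge> 1"
  shows "(\<Sum>s\<in>{1..m}. qcoth q s * qcoth q (s - m) - 1) =
    2 * (qcoth q m)\<^sup>2 - 2 * qcoth q m * (\<Sum>i\<in>{1..m}. qcoth q i) - 1"
proof -
  have m: "{1..m} = insert m {1..m-1}" using assms by auto
  have reflect: "(\<Sum>s\<in>{1..m-1}. qcoth q (m - s)) = (\<Sum>s\<in>{1..m-1}. qcoth q s)"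
    by (rule sum.reindex_bij_witness[of _ "\<lambda>s. m - s" "\<lambda>s. m - s"]) auto
  have "(\<Sum>s\<in>{1..m-1}. qcoth q s * qcoth q (s - m) - 1) =
      (\<Sum>s\<in>{1..m-1}. - qcoth q m * (qcoth q s + qcoth q (m - s)))"
  proof (rule sum.cong[OF refl])
    fix s assume "s \<in> {1..m-1}"
    then have "qcoth q s * qcoth q (m - s) = qcoth q m * (qcoth q s + qcoth q (m - s)) - 1"
      using qcoth_mult[OF q, of s "m - s"] by simp
    moreover have "qcoth q (s - m) = - qcoth q (m - s)"
      using qcoth_minus[OF q, of "m - s"] by simp
    ultimately show "qcoth q s * qcoth q (s - m) - 1 = - qcoth q m * (qcoth q s + qcoth q (m - s))"
      by simp
  qed
  also have "\<dots> = - 2 * qcoth q m * (\<Sum>s\<in>{1..m-1}. qcoth q s)"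
    unfolding sum_distrib_left[symmetric] sum.distrib reflect by simp
  finally show ?thesis
    unfolding m by (simp add: qcoth_0[OF q] power2_eq_square algebra_simps)
qed

text \<open>In the total of the shifts by \<open>m\<close> and by \<open>-m\<close> the partial sums
  of \<open>qcoth\<close> cancel; only a closed expression in \<open>m\<close> survives.\<close>

lemma has_sum_qcoth_shift_symmetric:
  assumes "m \<ge> 1"
  obtains a b where "((\<lambda>s. qcoth q s * qcoth q (s + m) - 1) has_sum a) {1..}"
    "((\<lambda>s. qcoth q s * qcoth q (s - m) - 1) has_sum b) {1..}"
    "a + b = 2 * (qcoth q m)\<^sup>2 - 2 * of_int m * qcoth q m - 1"
proof -
  define a where "a = qcoth q m * ((\<Sum>i\<in>{1..m}. qcoth q i) - of_int m)"
  have a: "((\<lambda>s. qcoth q s * qcoth q (s + m) - 1) has_sum a) {1..}"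
    unfolding a_def by (rule has_sum_qcoth_shift[OF assms])
  define f where "f s = qcoth q s * qcoth q (s - m) - 1" for s
  have tail: "(f has_sum a) {m+1..}"
    using a by (subst has_sum_reindex_bij_witness[of _ "\<lambda>s. s + m" "\<lambda>s. s - m" "{1..}"
          "\<lambda>s. qcoth q s * qcoth q (s + m) - 1"]) (auto simp: f_def mult.commute)
  have "(f has_sum ((\<Sum>s\<in>{1..m}. f s) + a)) ({1..m} \<union> {m+1..})"
    using tail by (intro has_sum_Un_disjoint) auto
  moreover have "{1..m} \<union> {m+1..} = {1..}" using assms by auto
  ultimately have b: "(f has_sum ((\<Sum>s\<in>{1..m}. f s) + a)) {1..}" by simp
  have "a + ((\<Sum>s\<in>{1..m}. f s) + a) = 2 * (qcoth q m)\<^sup>2 - 2 * of_int m * qcoth q m - 1"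
    unfolding f_def a_def sum_qcoth_reflect[OF assms] by (simp add: algebra_simps)
  then show ?thesis
    by (rule that[OF a b[unfolded f_def], folded f_def])
qed

text \<open>If \<open>s + m \<ge> 1\<close>, both factors are 1 up to a multiple of
  \<open>q^(2*s - 2*\<bar>m\<bar>)\<close>. Otherwise \<open>s \<le> \<bar>m\<bar>\<close>, so this
  power is at least 1 and a constant bound suffices.\<close>

lemma summable_qcoth_double:
  "(\<lambda>(s, m). (qcoth q s * qcoth q (s + m) - 1) * q powi (m\<^sup>2)) summable_on {1..} \<times> UNIV"
proof -
  define d where "d = 2 / (1 - q)"
  have d: "d \<ge> 0" using q by (simp add: d_def)
  define K where "K = (1 + d)\<^sup>2 + 1"
  have K: "\<bar>qcoth q s * qcoth q (s + m) - 1\<bar> \<le> K * q powi (2 * s - 2 * \<bar>m\<bar>)" if "s \<ge> 1" for s m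
  proof (cases "s + m \<ge> 1")
    case True
    define u v w where "u = q powi (2 * s)" and "v = q powi (2 * (s + m))" and "w = q powi (2 * s - 2 * \<bar>m\<bar>)"
    have uvw: "0 < u" "u \<le> 1" "0 < v" "u \<le> w" "v \<le> w"
      using q q_powi_mono[OF q, of 0 "2 * s"] that
      by (auto simp: u_def v_def w_def intro!: q_powi_mono[OF q])
    have b: "1 \<le> qcoth q s" "qcoth q s \<le> 1 + d * u" "1 \<le> qcoth q (s + m)" "qcoth q (s + m) \<le> 1 + d * v"
      using qcoth_bounds[OF q, of s] qcoth_bounds[OF q, of "s + m"] that True by (auto simp: d_def u_def v_def)
    have "1 * 1 \<le> qcoth q s * qcoth q (s + m)"
      by (intro mult_mono) (use b in auto)
    moreover have "qcoth q s * qcoth q (s + m) \<le> (1 + d * u) * (1 + d * v)"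
      by (intro mult_mono) (use b in auto)
    moreover have "(1 + d * u) * (1 + d * v) - 1 = d * u + d * v + d * d * (u * v)"
      by (simp add: algebra_simps)
    moreover have "u * v \<le> 1 * w"
      using uvw by (intro mult_mono) auto
    then have "d * u + d * v + d * d * (u * v) \<le> d * w + d * w + d * d * w"
      using uvw d by (intro add_mono mult_left_mono) auto
    moreover have "K * w = (d * w + d * w + d * d * w) + 2 * w"
      by (simp add: K_def power2_eq_square algebra_simps)
    ultimately show ?thesis using uvw unfolding w_def[symmetric] by linarith
  next
    case False
    have "\<bar>qcoth q s * qcoth q (s + m)\<bar> \<le> (1 + d) * (1 + d)"
      unfolding abs_mult using abs_qcoth_le[OF q] d by (intro mult_mono) (auto simp: d_def)
    then have "\<bar>qcoth q s * qcoth q (s + m) - 1\<bar> \<le> K * 1"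
      by (simp add: K_def power2_eq_square)
    also have "\<dots> \<le> K * q powi (2 * s - 2 * \<bar>m\<bar>)"
      using q_powi_mono[OF q, of "2 * s - 2 * \<bar>m\<bar>" 0] False that d
      by (intro mult_left_mono) (auto simp: K_def)
    finally show ?thesis .
  qed
  have bound: "\<bar>(qcoth q s * qcoth q (s + m) - 1) * q powi (m\<^sup>2)\<bar> \<le>
      K * (q powi (2 * s) * q powi (m\<^sup>2 - 2 * \<bar>m\<bar>))" if "s \<ge> 1" for s m
  proof -
    have "\<bar>(qcoth q s * qcoth q (s + m) - 1) * q powi (m\<^sup>2)\<bar> =
        \<bar>qcoth q s * qcoth q (s + m) - 1\<bar> * q powi (m\<^sup>2)"
      using q by (simp add: abs_mult)
    also have "\<dots> \<le> (K * q powi (2 * s - 2 * \<bar>m\<bar>)) * q powi (m\<^sup>2)"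
      using K[OF that] q by (intro mult_right_mono) auto
    also have "\<dots> = K * (q powi (2 * s) * q powi (m\<^sup>2 - 2 * \<bar>m\<bar>))"
      by (simp add: q_powi_add[OF q, symmetric] mult.assoc algebra_simps)
    finally show ?thesis .
  qed
  have "(\<lambda>(s, m). q powi (2 * s) * q powi (m\<^sup>2 - 2 * \<bar>m\<bar>)) summable_on {1..} \<times> (UNIV :: int set)"
    by (rule summable_on_product[OF summable_powi_double summable_gauss[OF q]]) (use q in auto)
  then have "(\<lambda>p. K * (case p of (s, m) \<Rightarrow> q powi (2 * s) * q powi (m\<^sup>2 - 2 * \<bar>m\<bar>))) summable_on {1..} \<times> (UNIV :: int set)"
    by (rule summable_on_cmult_right)
  then show ?thesis
    by (rule summable_on_abs_le) (use bound in auto)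
qed

lemma summable_linear_gauss: "(\<lambda>s::int. 2 * of_int s * qcoth q s * q powi (s\<^sup>2)) summable_on {1..}"
proof (rule summable_on_abs_le)
  have "(\<lambda>n. real n * q ^ n) summable_on {1..}"
    using has_sum_imp_summable[OF has_sum_linear_geometric[of q]] q by simp
  then have "(\<lambda>s::int. of_int s * q powi s) summable_on {1..}"
    by (subst summable_on_reindex_bij_witness[of _ int nat "{1..}" "\<lambda>n. real n * q ^ n"])
      (auto simp: power_int_def)
  then show "(\<lambda>s::int. 2 * (1 + 2 / (1 - q)) * (of_int s * q powi s)) summable_on {1..}"
    by (rule summable_on_cmult_right)
  show "\<bar>2 * of_int s * qcoth q s * q powi (s\<^sup>2)\<bar> \<le> 2 * (1 + 2 / (1 - q)) * (of_int s * q powi s)"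
    if "s \<in> {1..}" for s
  proof -
    have "s \<le> s\<^sup>2" using that by (simp add: power2_eq_square)
    then have "q powi (s\<^sup>2) \<le> q powi s" by (rule q_powi_mono[OF q])
    then have "\<bar>qcoth q s\<bar> * q powi (s\<^sup>2) \<le> (1 + 2 / (1 - q)) * q powi s"
      using abs_qcoth_le[OF q, of s] q by (intro mult_mono) auto
    then have "2 * of_int s * (\<bar>qcoth q s\<bar> * q powi (s\<^sup>2)) \<le> 2 * of_int s * ((1 + 2 / (1 - q)) * q powi s)"
      using that by (intro mult_left_mono) auto
    then show ?thesis
      using that q by (simp add: abs_mult mult_ac)
  qed
qed

lemma qtheta_ge_1: "qtheta q \<ge> 1"
  using finite_sum_le_has_sum[OF has_sum_qtheta[OF q, of 0], of "{0}"] q by simp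

text \<open>Double summation of \<open>f\<close>. Its rows are given by
  \<open>qtheta_mult_qpartial\<close>; its columns \<open>m\<close> and \<open>-m\<close> are folded
  together, and column 0 is \<open>Y\<close>. Both evaluations contain the same correction
  \<open>D\<close>, which drops out.\<close>

lemma qtheta_mult_series:
  obtains X Y where
    "((\<lambda>m. (2 * (qcoth q m)\<^sup>2 - 1) * q powi (m\<^sup>2)) has_sum X) {1..}"
    "((\<lambda>s. (qcoth q s)\<^sup>2 - 1) has_sum Y) {1..}"
    "((\<lambda>s. 2 * (qcoth q s * qpartial q s - 1)) has_sum (2 * (X + Y) / qtheta q)) {1..}"
proof -
  define f where "f = (\<lambda>(s, m). (qcoth q s * qcoth q (s + m) - 1) * q powi (m\<^sup>2))"
  obtain T where T: "(f has_sum T) ({1..} \<times> UNIV)"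
    using summable_qcoth_double by (auto simp: f_def summable_on_def)
  obtain D where D: "((\<lambda>s::int. 2 * of_int s * qcoth q s * q powi (s\<^sup>2)) has_sum D) {1..}"
    using summable_linear_gauss by (auto simp: summable_on_def)
  have row: "((\<lambda>m. f (s, m)) has_sum (qtheta q * (qcoth q s * qpartial q s - 1)
      - 2 * of_int s * qcoth q s * q powi (s\<^sup>2))) UNIV" if "s \<in> {1..}" for s
  proof -
    have "((\<lambda>m. qcoth q (s + m) * q powi (m\<^sup>2)) has_sum
        (qtheta q * qpartial q s - 2 * of_int s * q powi (s\<^sup>2))) UNIV"
      using qtheta_mult_qpartial[OF q, of s] that
      by (subst has_sum_reindex_bij_witness[of _ "\<lambda>j. j - s" "\<lambda>m. s + m" UNIV
            "\<lambda>j. qcoth q j * q powi ((j - s)\<^sup>2)"]) auto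
    from has_sum_minus[OF has_sum_cmult_right[OF this, of "qcoth q s"] has_sum_qtheta[OF q, of 0]]
    show ?thesis by (simp add: f_def algebra_simps)
  qed
  have "((\<lambda>s. qtheta q * (qcoth q s * qpartial q s - 1) - 2 * of_int s * qcoth q s * q powi (s\<^sup>2)) has_sum T) {1..}"
    by (rule has_sum_SigmaD[OF T row])
  from has_sum_add[OF this D]
  have "((\<lambda>s. qtheta q * (qcoth q s * qpartial q s - 1)) has_sum (T + D)) {1..}" by simp
  from has_sum_cmult_right[OF this, of "2 / qtheta q"]
  have "((\<lambda>s. 2 / qtheta q * (qtheta q * (qcoth q s * qpartial q s - 1))) has_sum (2 / qtheta q * (T + D))) {1..}" .
  moreover have "2 / qtheta q * (qtheta q * x) = 2 * x" for x
    using qtheta_ge_1 by simp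
  ultimately have 1: "((\<lambda>s. 2 * (qcoth q s * qpartial q s - 1)) has_sum (2 * (T + D) / qtheta q)) {1..}"
    by (simp only: times_divide_eq_left)
  define k where "k m = (\<Sum>\<^sub>\<infinity>s\<in>{1..}. f (s, m))" for m
  have col: "((\<lambda>s. f (s, m)) has_sum k m) {1..}" for m
  proof -
    have "((\<lambda>(m, s). f (s, m)) summable_on UNIV \<times> {1..})"
      using has_sum_imp_summable[OF T] by (subst (asm) summable_on_swap)
    from summable_on_SigmaD1[OF this, of m] show ?thesis by (simp add: k_def)
  qed
  have "((\<lambda>(m, s). f (s, m)) has_sum T) (UNIV \<times> {1..})"
    using T by (subst (asm) has_sum_swap)
  then have "(k has_sum T) UNIV"
    by (rule has_sum_SigmaD) (use col in auto)
  from has_sum_add[OF has_sum_int_fold[OF this] D]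
  have "((\<lambda>m. k m + k (- m) + 2 * of_int m * qcoth q m * q powi (m\<^sup>2)) has_sum (T - k 0 + D)) {1..}" .
  moreover have "k m + k (- m) + 2 * of_int m * qcoth q m * q powi (m\<^sup>2) = (2 * (qcoth q m)\<^sup>2 - 1) * q powi (m\<^sup>2)"
    if m: "m \<in> {1..}" for m
  proof -
    obtain a b where ab: "((\<lambda>s. qcoth q s * qcoth q (s + m) - 1) has_sum a) {1..}"
      "((\<lambda>s. qcoth q s * qcoth q (s - m) - 1) has_sum b) {1..}"
      "a + b = 2 * (qcoth q m)\<^sup>2 - 2 * of_int m * qcoth q m - 1"
      using has_sum_qcoth_shift_symmetric[of m] m by auto
    have "((\<lambda>s. f (s, m)) has_sum (a * q powi (m\<^sup>2))) {1..}"
      using has_sum_cmult_left[OF ab(1)] by (simp add: f_def)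
    then have "k m = a * q powi (m\<^sup>2)" using has_sum_unique[OF col] by simp
    moreover have "((\<lambda>s. f (s, - m)) has_sum (b * q powi (m\<^sup>2))) {1..}"
      using has_sum_cmult_left[OF ab(2)] by (simp add: f_def)
    then have "k (- m) = b * q powi (m\<^sup>2)" using has_sum_unique[OF col] by simp
    ultimately have "k m + k (- m) = (a + b) * q powi (m\<^sup>2)" by (simp add: algebra_simps)
    then show ?thesis by (simp add: ab(3) algebra_simps)
  qed
  ultimately have 2: "((\<lambda>m. (2 * (qcoth q m)\<^sup>2 - 1) * q powi (m\<^sup>2)) has_sum (T - k 0 + D)) {1..}"
    by (subst has_sum_cong[where g = "\<lambda>m. k m + k (- m) + 2 * of_int m * qcoth q m * q powi (m\<^sup>2)"]) auto
  have 3: "((\<lambda>s. (qcoth q s)\<^sup>2 - 1) has_sum k 0) {1..}"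
    using col[of 0] by (simp add: f_def power2_eq_square)
  show ?thesis
    by (rule that[OF 2 3]) (use 1 in \<open>simp add: algebra_simps\<close>)
qed

end

section \<open>Comparison of coefficients\<close>

lemma powser_zero_imp_first_zero:
  fixes a :: "nat \<Rightarrow> real"
  assumes "\<And>x. 0 < x \<Longrightarrow> x < 1 \<Longrightarrow> (\<lambda>n. a n * x ^ n) sums 0"
  shows "a 0 = 0"
proof -
  have half: "summable (\<lambda>n. a n * (1/2) ^ n)"
    using assms[of "1/2"] by (simp add: sums_iff)
  have "summable (\<lambda>n. a n * x ^ n)" if "norm x < 1/2" for x
    by (rule powser_inside[OF half]) (use that in simp)
  then have "(\<lambda>n. a n * x ^ n) sums (\<Sum>n. a n * x ^ n)" if "norm x < 1/2" for x
    using that by (intro summable_sums) simp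
  then have "((\<lambda>x. \<Sum>n. a n * x ^ n) \<longlongrightarrow> a 0) (at 0)"
    by (rule powser_limit_0[OF half_gt_zero[OF zero_less_one]])
  \<comment> \<open>The hypothesis covers positive \<open>x\<close> only, so the limits are compared
    from the right.\<close>
  then have "((\<lambda>x. \<Sum>n. a n * x ^ n) \<longlongrightarrow> a 0) (at_right 0)"
    by (rule filterlim_at_split[THEN iffD1, THEN conjunct2])
  moreover have "eventually (\<lambda>x. (\<Sum>n. a n * x ^ n) = 0) (at_right (0 :: real))"
    unfolding eventually_at_right[OF zero_less_one]
    using assms by (intro exI[of _ 1]) (auto intro!: sums_unique[symmetric])
  then have "((\<lambda>x. \<Sum>n. a n * x ^ n) \<longlongrightarrow> 0) (at_right (0 :: real))"
    by (rule tendsto_eventually)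
  ultimately show ?thesis
    using tendsto_unique trivial_limit_at_right_real by blast
qed

lemma powser_zero_imp_coeff_zero:
  fixes a :: "nat \<Rightarrow> real"
  assumes "\<And>x. 0 < x \<Longrightarrow> x < 1 \<Longrightarrow> (\<lambda>n. a n * x ^ n) sums 0"
  shows "a n = 0"
  using assms
proof (induction n arbitrary: a)
  case (0 a)
  then show ?case by (rule powser_zero_imp_first_zero)
next
  case (Suc n a)
  have a0: "a 0 = 0" using Suc.prems by (rule powser_zero_imp_first_zero)
  show ?case
  proof (rule Suc.IH)
    fix x :: real assume x: "0 < x" "x < 1"
    have "(\<lambda>n. a (Suc n) * x ^ Suc n) sums 0"
      using Suc.prems[OF x] by (subst sums_Suc_iff) (simp add: a0)
    from sums_divide[OF this, of x] show "(\<lambda>n. a (Suc n) * x ^ n) sums 0"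
      using x by simp
  qed
qed

lemma one_sums: "(\<lambda>n. (if n = 0 then 1 else 0) * x ^ n) sums (1 :: real)"
proof -
  have "(\<lambda>n. (if n = 0 then 1 else 0) * x ^ n) = (\<lambda>n. if n = 0 then 1 else 0)"
    by auto
  then show ?thesis using sums_single[of 0 "\<lambda>_. 1 :: real"] by simp
qed

section \<open>The coefficients occurring in the relation\<close>

definition theta_coeff :: "nat \<Rightarrow> real" where
  "theta_coeff n = (if n = 0 then 1 else if \<exists>k. n = k\<^sup>2 then 2 else 0)"

text \<open>Coefficients of \<open>qtheta q - 2 * (X + Y)\<close> with \<open>X\<close>,
  \<open>Y\<close> from \<open>qtheta_mult_series\<close>. They result from
  \<open>qcoth^2 = 1 + 4*x / (1 - x)^2\<close> with \<open>x = q^(2*m)\<close> and the expansion of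
  \<open>x / (1 - x)^2\<close> as \<open>\<Sum> i * x^i\<close>.\<close>

definition lambert_coeff :: "nat \<Rightarrow> real" where
  "lambert_coeff n = (if n = 0 then 1 else 0)
     - 16 * (\<Sum>(m, i)\<in>{1..n} \<times> {1..n}. if m\<^sup>2 + 2 * m * i = n then real i else 0)
     - 8 * (\<Sum>(s, i)\<in>{1..n} \<times> {1..n}. if 2 * s * i = n then real i else 0)"

text \<open>
  Both end points \<open>t = s\<close> and \<open>t = -s\<close> carry half the weight and the same exponent; they are
  merged into \<open>t = s\<close>.
\<close>

definition form_weight :: "int \<times> int \<times> nat \<Rightarrow> real" where
  "form_weight = (\<lambda>(s, t, i). if i > 0 then 4 else if t = s then 0 else 2)"

definition form_exponent :: "int \<times> int \<times> nat \<Rightarrow> nat" where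
  "form_exponent = (\<lambda>(s, t, i). nat (s\<^sup>2 - t\<^sup>2 + 2 * s * int i))"

definition form_domain :: "(int \<times> int \<times> nat) set" where
  "form_domain = (SIGMA s:{1..}. {-s<..s} \<times> UNIV)"

definition form_coeff :: "nat \<Rightarrow> real" where
  "form_coeff n = infsum form_weight {p \<in> form_domain. form_exponent p = n}"

lemma form_coeff_nonneg: "form_coeff n \<ge> 0"
  unfolding form_coeff_def by (rule infsum_nonneg) (auto simp: form_weight_def)

lemma powi_eq_power: "z \<ge> 0 \<Longrightarrow> q powi z = q ^ nat z"
  by (simp add: power_int_def)

lemma abs_le_imp_power2_le: "-s < t \<Longrightarrow> t \<le> s \<Longrightarrow> t\<^sup>2 \<le> (s::int)\<^sup>2"
  by (rule power2_le_iff_abs_le[THEN iffD2]) auto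

lemma has_sum_geometric:
  fixes x :: real
  assumes "0 \<le> x" "x < 1"
  shows "((\<lambda>i. x ^ i) has_sum (1 / (1 - x))) UNIV"
  using geometric_sums[of x] assms by (intro sums_nonneg_imp_has_sum) auto

context
  fixes q :: real
  assumes q: "0 < q" "q < 1"
begin

lemma has_sum_form_weight_row:
  assumes "s > 0" "-s < t" "t \<le> s"
  shows "((\<lambda>i. form_weight (s, t, i) * q ^ form_exponent (s, t, i)) has_sum
    (q powi (s\<^sup>2 - t\<^sup>2) * (4 / (1 - q powi (2 * s)) - (if t = s then 4 else 2)))) UNIV"
proof -
  define x where "x = q powi (2 * s)"
  have x: "0 \<le> x" "x < 1"
    using q q_powi_mono[OF q, of 1 "2 * s"] assms by (auto simp: x_def)
  have exp: "q ^ form_exponent (s, t, i) = q powi (s\<^sup>2 - t\<^sup>2) * x ^ i" for i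
  proof -
    have "x ^ i = q powi (2 * s * int i)" by (simp add: x_def power_int_mult)
    moreover have "0 \<le> s\<^sup>2 - t\<^sup>2 + 2 * s * int i"
      using abs_le_imp_power2_le[OF assms(2,3)] assms(1) by simp
    ultimately show ?thesis
      by (simp add: form_exponent_def powi_eq_power[symmetric] q_powi_add[OF q])
  qed
  have "((\<lambda>i. 4 * x ^ i - (if i = 0 then if t = s then 4 else 2 else 0)) has_sum
      (4 * (1 / (1 - x)) - (if t = s then 4 else 2))) UNIV"
    by (intro has_sum_minus has_sum_cmult_right has_sum_geometric x has_sum_finite_neutralI[of "{0}"]) auto
  from has_sum_cmult_right[OF this, of "q powi (s\<^sup>2 - t\<^sup>2)"]
  have "((\<lambda>i. q powi (s\<^sup>2 - t\<^sup>2) * (4 * x ^ i - (if i = 0 then if t = s then 4 else 2 else 0))) has_sum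
      (q powi (s\<^sup>2 - t\<^sup>2) * (4 / (1 - x) - (if t = s then 4 else 2)))) UNIV" by simp
  then show ?thesis
    unfolding x_def[symmetric]
    by (rule has_sum_cong[THEN iffD1, rotated]) (auto simp: exp form_weight_def)
qed

text \<open>For \<open>t < s\<close> the halved weight at \<open>i = 0\<close> cancels the constant
  in \<open>4 / (1 - x) = 2 * qcoth q s + 2\<close>. At \<open>t = s\<close> the weight 0 takes away
  another 2, and this is the subtracted 1.\<close>

lemma has_sum_form_weight_slice:
  assumes "s > 0"
  shows "((\<lambda>p. form_weight (s, p) * q ^ form_exponent (s, p)) has_sum
    (2 * (qcoth q s * qpartial q s - 1))) ({-s<..s} \<times> UNIV)"
proof -
  define x where "x = q powi (2 * s)"
  have x: "0 \<le> x" "x < 1"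
    using q q_powi_mono[OF q, of 1 "2 * s"] assms by (auto simp: x_def)
  have c: "4 / (1 - x) = 2 * qcoth q s + 2"
  proof -
    have "qcoth q s = 1 + 2 * (x / (1 - x))"
      unfolding x_def by (rule qcoth_eq[OF q assms])
    then show ?thesis using x by (simp add: field_simps)
  qed
  define g where "g t = q powi (s\<^sup>2 - t\<^sup>2) * (4 / (1 - x) - (if t = s then 4 else 2))" for t
  have row: "((\<lambda>i. form_weight (s, t, i) * q ^ form_exponent (s, t, i)) has_sum g t) UNIV"
    if "t \<in> {-s<..s}" for t
    unfolding g_def x_def using has_sum_form_weight_row[of s t] assms that by auto
  have g: "(g has_sum (\<Sum>t\<in>{-s<..s}. g t)) {-s<..s}"
    by (rule has_sum_finiteI) auto
  have "(\<Sum>t\<in>{-s<..s}. g t) = (\<Sum>t\<in>{-s<..s}. 2 * qcoth q s * q powi (s\<^sup>2 - t\<^sup>2) - (if t = s then 2 else 0))"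
    by (intro sum.cong refl) (auto simp: g_def c algebra_simps)
  also have "\<dots> = 2 * qcoth q s * (\<Sum>t\<in>{-s<..s}. q powi (s\<^sup>2 - t\<^sup>2)) - 2"
    using assms by (simp add: sum_subtractf sum_distrib_left)
  also have "(\<Sum>t\<in>{-s<..s}. q powi (s\<^sup>2 - t\<^sup>2)) = qpartial q s"
    unfolding qpartial_def by (rule sum.reindex_bij_witness[of _ uminus uminus]) auto
  finally have sum_g: "(\<Sum>t\<in>{-s<..s}. g t) = 2 * (qcoth q s * qpartial q s - 1)" by simp
  have "(\<lambda>p. form_weight (s, p) * q ^ form_exponent (s, p)) summable_on ({-s<..s} \<times> UNIV)"
    by (rule summable_on_SigmaI[OF row has_sum_imp_summable[OF g]])
      (use q in \<open>auto simp: form_weight_def\<close>)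
  from has_sum_SigmaI[OF row g this] show ?thesis unfolding sum_g .
qed

lemma has_sum_form_weight:
  assumes "((\<lambda>s. 2 * (qcoth q s * qpartial q s - 1)) has_sum b) {1..}"
  shows "((\<lambda>p. form_weight p * q ^ form_exponent p) has_sum b) form_domain"
proof -
  have slice: "((\<lambda>p. form_weight (s, p) * q ^ form_exponent (s, p)) has_sum
    (2 * (qcoth q s * qpartial q s - 1))) ({-s<..s} \<times> UNIV)" if "s \<in> {1..}" for s
    using has_sum_form_weight_slice[of s] that by auto
  have "(\<lambda>p. form_weight p * q ^ form_exponent p) summable_on form_domain"
    unfolding form_domain_def
    by (rule summable_on_SigmaI[OF slice has_sum_imp_summable[OF assms]])
      (use q in \<open>auto simp: form_weight_def\<close>)
  then show ?thesis
    unfolding form_domain_def by (intro has_sum_SigmaI[OF slice assms])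
qed

lemma theta_sums: "(\<lambda>n. theta_coeff n * q ^ n) sums qtheta q"
proof -
  have "((\<lambda>k::int. 1 * q ^ nat (k\<^sup>2)) has_sum qtheta q) UNIV"
    using has_sum_qtheta[OF q, of 0] by (simp add: powi_eq_power)
  from has_sum_powser(1)[OF this] q
  have "((\<lambda>n. infsum (\<lambda>_. 1) {k::int. nat (k\<^sup>2) = n} * q ^ n) has_sum qtheta q) UNIV" by simp
  moreover have "infsum (\<lambda>_. 1) {k::int. nat (k\<^sup>2) = n} = theta_coeff n" for n
  proof (cases "\<exists>k. n = k\<^sup>2")
    case True
    then obtain k where k: "n = k\<^sup>2" by blast
    have "nat (j\<^sup>2) = n \<longleftrightarrow> j = int k \<or> j = - int k" for j
      by (simp add: k nat_eq_iff) (metis of_nat_power power2_eq_iff)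
    then have "{j. nat (j\<^sup>2) = n} = {int k, - int k}" by auto
    then show ?thesis using k True by (cases "k = 0") (auto simp: theta_coeff_def card_insert_if)
  next
    case False
    have "nat (j\<^sup>2) \<noteq> n" for j
    proof
      assume "nat (j\<^sup>2) = n"
      then have "n = (nat \<bar>j\<bar>)\<^sup>2" by (simp add: nat_power_eq[symmetric])
      then show False using False by blast
    qed
    moreover have "n \<noteq> 0" using False by (metis power_zero_numeral)
    ultimately show ?thesis using False by (auto simp: theta_coeff_def)
  qed
  ultimately show ?thesis by (intro has_sum_imp_sums) simp
qed

lemma has_sum_double_lambert:
  fixes e :: "nat \<Rightarrow> nat"
  assumes "((\<lambda>m. q ^ e m * (q ^ (2 * m) / (1 - q ^ (2 * m))\<^sup>2)) has_sum S) {1..}"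
  shows "((\<lambda>(m, i). real i * q ^ (e m + 2 * m * i)) has_sum S) ({1..} \<times> {1..})"
proof -
  have row: "((\<lambda>i. case (m, i) of (m, i) \<Rightarrow> real i * q ^ (e m + 2 * m * i)) has_sum
      (q ^ e m * (q ^ (2 * m) / (1 - q ^ (2 * m))\<^sup>2))) {1..}" if "m \<in> {1..}" for m
  proof -
    have "q ^ (2 * m) < 1" using that q by (intro power_less_one_iff[THEN iffD2]) auto
    then have "((\<lambda>i. real i * (q ^ (2 * m)) ^ i) has_sum (q ^ (2 * m) / (1 - q ^ (2 * m))\<^sup>2)) {1..}"
      using q by (intro has_sum_linear_geometric) auto
    from has_sum_cmult_right[OF this, of "q ^ e m"] show ?thesis
      by (simp add: power_add power_mult[symmetric] mult_ac)
  qed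
  have "(\<lambda>(m, i). real i * q ^ (e m + 2 * m * i)) summable_on ({1..} \<times> {1..})"
    by (rule summable_on_SigmaI[OF row has_sum_imp_summable[OF assms]]) (use q in auto)
  from has_sum_SigmaI[OF row assms this] show ?thesis .
qed

text \<open>Applied with \<open>e m = m\<^sup>2\<close> and with \<open>e m = 0\<close>, for the two
  sums in \<open>lambert_coeff\<close>.\<close>

lemma double_lambert_sums:
  fixes e :: "nat \<Rightarrow> nat"
  assumes "((\<lambda>m. q ^ e m * (q ^ (2 * m) / (1 - q ^ (2 * m))\<^sup>2)) has_sum S) {1..}"
  shows "(\<lambda>n. (\<Sum>(m, i)\<in>{1..n} \<times> {1..n}. if e m + 2 * m * i = n then real i else 0) * q ^ n) sums S"
proof -
  have "((\<lambda>p. (case p of (m, i) \<Rightarrow> real i) * q ^ (case p of (m, i) \<Rightarrow> e m + 2 * m * i)) has_sum S) ({1..} \<times> {1..})"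
    using has_sum_double_lambert[OF assms] by (simp add: case_prod_unfold)
  from has_sum_powser(1)[OF this] q
  have "((\<lambda>n. infsum (\<lambda>(m, i). real i) {p \<in> {1..} \<times> {1..}. (case p of (m, i) \<Rightarrow> e m + 2 * m * i) = n} * q ^ n)
      has_sum S) UNIV" by simp
  moreover have "infsum (\<lambda>(m, i). real i) {p \<in> {1..} \<times> {1..}. (case p of (m, i) \<Rightarrow> e m + 2 * m * i) = n} =
      (\<Sum>(m, i)\<in>{1..n} \<times> {1..n}. if e m + 2 * m * i = n then real i else 0)" for n
  proof -
    have sub: "{p \<in> {1..} \<times> {1..}. (case p of (m, i) \<Rightarrow> e m + 2 * m * i) = n} \<subseteq> {1..n} \<times> {1..n}"
    proof safe
      fix m i :: nat assume "1 \<le> m" "1 \<le> i"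
      then have "m * 1 \<le> m * i" "1 * i \<le> m * i" by (intro mult_mono; simp)+
      then have "m \<le> e m + 2 * m * i" "i \<le> e m + 2 * m * i" by linarith+
      with \<open>1 \<le> m\<close> \<open>1 \<le> i\<close> show "m \<in> {1..e m + 2 * m * i}" "i \<in> {1..e m + 2 * m * i}" by auto
    qed
    then have "finite {p \<in> {1..} \<times> {1..}. (case p of (m, i) \<Rightarrow> e m + 2 * m * i) = n}"
      by (rule finite_subset) auto
    then have "infsum (\<lambda>(m, i). real i) {p \<in> {1..} \<times> {1..}. (case p of (m, i) \<Rightarrow> e m + 2 * m * i) = n} =
       (\<Sum>(m, i)\<in>{p \<in> {1..} \<times> {1..}. (case p of (m, i) \<Rightarrow> e m + 2 * m * i) = n}. real i)"
      by (rule infsum_finite)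
    also have "\<dots> = (\<Sum>(m, i)\<in>{1..n} \<times> {1..n}. if e m + 2 * m * i = n then real i else 0)"
      using sub by (intro sum.mono_neutral_cong_left) (auto split: if_splits)
    finally show ?thesis .
  qed
  ultimately show ?thesis by (intro has_sum_imp_sums) simp
qed

text \<open>The number \<open>q\<close> is auxiliary: convergence of the whole series at one point
  makes the weights summable on each fibre, and then a single nonnegative weight bounds the sum from
  below.\<close>

lemma form_weight_le_form_coeff:
  assumes "p \<in> form_domain" "form_exponent p = n"
  shows "form_weight p \<le> form_coeff n"
proof -
  obtain b where b: "((\<lambda>s. 2 * (qcoth q s * qpartial q s - 1)) has_sum b) {1..}"
    by (rule qtheta_mult_series[OF q])
  have "q \<noteq> 0" using q by simp
  have "sum form_weight {p} \<le> form_coeff n"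
    unfolding form_coeff_def
    by (rule finite_sum_le_infsum[OF has_sum_powser(2)[OF has_sum_form_weight[OF b] \<open>q \<noteq> 0\<close>]])
      (use assms in \<open>auto simp: form_weight_def\<close>)
  then show ?thesis by simp
qed

text \<open>The identity of \<open>qtheta_mult_series\<close> with both sides expanded in powers of
  \<open>q\<close>; here \<open>qtheta q * b = 2 * (X + Y)\<close>.\<close>

lemma form_and_lambert_sums:
  obtains b where "(\<lambda>n. form_coeff n * q ^ n) sums b"
    "(\<lambda>n. lambert_coeff n * q ^ n) sums (qtheta q * (1 - b))"
proof -
  obtain X Y where X: "((\<lambda>m. (2 * (qcoth q m)\<^sup>2 - 1) * q powi (m\<^sup>2)) has_sum X) {1..}"
    and Y: "((\<lambda>s. (qcoth q s)\<^sup>2 - 1) has_sum Y) {1..}"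
    and b: "((\<lambda>s. 2 * (qcoth q s * qpartial q s - 1)) has_sum (2 * (X + Y) / qtheta q)) {1..}"
    by (rule qtheta_mult_series[OF q])
  define b' where "b' = 2 * (X + Y) / qtheta q"
  have "q \<noteq> 0" using q by simp
  have form: "(\<lambda>n. form_coeff n * q ^ n) sums b'"
    using has_sum_powser(1)[OF has_sum_form_weight[OF b] \<open>q \<noteq> 0\<close>]
    unfolding form_coeff_def b'_def by (rule has_sum_imp_sums)
  define g where "g m = q ^ (2 * m) / (1 - q ^ (2 * m))\<^sup>2" for m :: nat
  have c2: "(qcoth q (int m))\<^sup>2 = 1 + 4 * g m" if "m \<ge> 1" for m
  proof -
    define x where "x = q ^ (2 * m)"
    have "x < 1" using that q unfolding x_def by (intro power_less_one_iff[THEN iffD2]) auto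
    moreover have "q powi (2 * int m) = x"
      using power_int_of_nat[of q "2 * m"] by (simp add: x_def)
    then have "qcoth q (int m) = (1 + x) / (1 - x)" using that by (simp add: qcoth_def)
    moreover have "(1 + x)\<^sup>2 = (1 - x)\<^sup>2 + 4 * x"
      by (simp add: power2_eq_square algebra_simps)
    ultimately have "(qcoth q (int m))\<^sup>2 = ((1 - x)\<^sup>2 + 4 * x) / (1 - x)\<^sup>2"
      by (simp only: power_divide)
    then show ?thesis
      unfolding g_def x_def[symmetric] using \<open>x < 1\<close> by (simp add: add_divide_distrib)
  qed
  have int_nat: "((\<lambda>m. f (int m)) has_sum S) {1..} \<longleftrightarrow> (f has_sum S) {1..}" for f :: "int \<Rightarrow> real" and S
    by (rule has_sum_reindex_bij_witness[of _ nat int]) auto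
  have qsq: "q powi ((int m)\<^sup>2) = q ^ (m\<^sup>2)" for m
    using power_int_of_nat[of q "m\<^sup>2"] by simp
  have theta: "((\<lambda>m. 2 * q ^ (m\<^sup>2)) has_sum (qtheta q - 1)) {1..}"
  proof -
    have "((\<lambda>m::int. 2 * q powi (m\<^sup>2)) has_sum (qtheta q - 1)) {1..}"
      using has_sum_int_fold[OF has_sum_qtheta[OF q, of 0]] by simp
    from int_nat[THEN iffD2, OF this] show ?thesis by (simp only: qsq)
  qed
  \<comment> \<open>Subtracting \<open>qtheta q - 1\<close> removes the constant part of
    \<open>2 * (2 * qcoth\<^sup>2 - 1) = 2 + 16 * g\<close>.\<close>
  have "((\<lambda>m. 2 * ((2 * (qcoth q (int m))\<^sup>2 - 1) * q powi ((int m)\<^sup>2)) - 2 * q ^ (m\<^sup>2)) has_sum (2 * X - (qtheta q - 1))) {1..}"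
    by (intro has_sum_minus theta has_sum_cmult_right) (rule int_nat[THEN iffD2, OF X])
  then have "((\<lambda>m. 16 * (q ^ (m\<^sup>2) * g m)) has_sum (2 * X - (qtheta q - 1))) {1..}"
    by (rule has_sum_cong[THEN iffD1, rotated]) (auto simp: c2 qsq algebra_simps)
  from has_sum_divide_const[OF this, of 16]
  have 1: "((\<lambda>m. q ^ (m\<^sup>2) * g m) has_sum ((2 * X - (qtheta q - 1)) / 16)) {1..}" by simp
  have "((\<lambda>m. (qcoth q (int m))\<^sup>2 - 1) has_sum Y) {1..}"
    by (rule int_nat[THEN iffD2, OF Y])
  then have "((\<lambda>m. 4 * g m) has_sum Y) {1..}"
    by (rule has_sum_cong[THEN iffD1, rotated]) (auto simp: c2)
  from has_sum_divide_const[OF this, of 4]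
  have 2: "((\<lambda>m. q ^ 0 * g m) has_sum (Y / 4)) {1..}" by simp
  have "(\<lambda>n. (if n = 0 then 1 else 0) * q ^ n
      - 16 * ((\<Sum>(m, i)\<in>{1..n} \<times> {1..n}. if m\<^sup>2 + 2 * m * i = n then real i else 0) * q ^ n)
      - 8 * ((\<Sum>(s, i)\<in>{1..n} \<times> {1..n}. if 0 + 2 * s * i = n then real i else 0) * q ^ n))
    sums (1 - 16 * ((2 * X - (qtheta q - 1)) / 16) - 8 * (Y / 4))"
    using 1 2 unfolding g_def
    by (intro sums_diff sums_mult one_sums double_lambert_sums[of "\<lambda>m. m\<^sup>2"] double_lambert_sums[of "\<lambda>_. 0"]) auto
  moreover have "1 - 16 * ((2 * X - (qtheta q - 1)) / 16) - 8 * (Y / 4) = qtheta q * (1 - b')"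
  proof -
    have "qtheta q * b' = 2 * (X + Y)"
      using qtheta_ge_1[OF q] by (simp add: b'_def)
    then have "qtheta q * (1 - b') = qtheta q - 2 * (X + Y)"
      by (simp add: right_diff_distrib)
    moreover have "1 - 16 * ((2 * X - (qtheta q - 1)) / 16) - 8 * (Y / 4) = qtheta q - 2 * (X + Y)"
    proof -
      have "16 * (z / 16) = z" "8 * (Y / 4) = 2 * Y" for z :: real by simp_all
      then show ?thesis by (simp only:) (simp add: algebra_simps)
    qed
    ultimately show ?thesis by (simp only:)
  qed
  moreover have "lambert_coeff n * q ^ n = (if n = 0 then 1 else 0) * q ^ n
      - 16 * ((\<Sum>(m, i)\<in>{1..n} \<times> {1..n}. if m\<^sup>2 + 2 * m * i = n then real i else 0) * q ^ n)
      - 8 * ((\<Sum>(s, i)\<in>{1..n} \<times> {1..n}. if 0 + 2 * s * i = n then real i else 0) * q ^ n)" for n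
    unfolding lambert_coeff_def left_diff_distrib mult.assoc add_0 ..
  ultimately have "(\<lambda>n. lambert_coeff n * q ^ n) sums (qtheta q * (1 - b'))"
    by (simp only:)
  from form this show ?thesis by (rule that)
qed

end

lemma form_coeff_ge:
  assumes "n \<ge> 2"
  shows "form_coeff n \<ge> 4"
proof -
  \<comment> \<open>Any point of the unit interval would serve in place of \<open>1/2\<close>. In
    both witnesses below \<open>n \<ge> 2\<close> forces \<open>k > 0\<close>, hence the full weight
    4.\<close>
  have lower: "form_weight p \<le> form_coeff n" if "p \<in> form_domain" "form_exponent p = n" for p
    by (rule form_weight_le_form_coeff[of "1/2"]) (use that in simp_all)
  show ?thesis
  proof (cases "even n")
    case True
    then obtain k where "n = 2 * k" by blast
    then show ?thesis using lower[of "(1, 1, k)"] assms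
      by (simp add: form_domain_def form_exponent_def form_weight_def nat_mult_distrib)
  next
    case False
    then obtain k where "n = 2 * k + 1" by (rule oddE)
    then show ?thesis using lower[of "(1, 0, k)"] assms
      by (simp add: form_domain_def form_exponent_def form_weight_def nat_add_distrib nat_mult_distrib)
  qed
qed

text \<open>Transfer from numbers in the unit interval to formal power series. The Cauchy product is
  legitimate because all coefficients of the theta and the form series are nonnegative, so
  convergence is absolute.\<close>

lemma theta_mult_form:
  "Abs_fps theta_coeff * (1 - Abs_fps form_coeff) = Abs_fps lambert_coeff"
proof (rule fps_ext)
  fix n
  define a where "a n = (\<Sum>i\<le>n. theta_coeff i * ((1 - Abs_fps form_coeff) $ (n - i)))" for n
  have "a n - lambert_coeff n = 0"
  proof (rule powser_zero_imp_coeff_zero)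
    fix x :: real assume x: "0 < x" "x < 1"
    obtain b where form: "(\<lambda>n. form_coeff n * x ^ n) sums b"
      and lambert: "(\<lambda>n. lambert_coeff n * x ^ n) sums (qtheta x * (1 - b))"
      by (rule form_and_lambert_sums[OF x])
    have form': "(\<lambda>n. (1 - Abs_fps form_coeff) $ n * x ^ n) sums (1 - b)"
      using sums_diff[OF one_sums form] by (simp add: left_diff_distrib)
    have "summable (\<lambda>n. norm ((1 - Abs_fps form_coeff) $ n * x ^ n))"
    proof (rule summable_comparison_test')
      show "summable (\<lambda>n. (if n = 0 then 1 else 0) * x ^ n + form_coeff n * x ^ n)"
        using sums_add[OF one_sums form] by (simp add: sums_iff)
      show "norm (norm ((1 - Abs_fps form_coeff) $ n * x ^ n)) \<le>
          (if n = 0 then 1 else 0) * x ^ n + form_coeff n * x ^ n" for n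
        using x form_coeff_nonneg[of n] by (auto simp: abs_mult intro!: mult_right_mono simp flip: distrib_right)
    qed
    moreover have "summable (\<lambda>n. norm (theta_coeff n * x ^ n))"
    proof -
      have "norm (theta_coeff n * x ^ n) = theta_coeff n * x ^ n" for n
        using x by (simp add: theta_coeff_def)
      then show ?thesis using theta_sums[OF x] by (simp add: sums_iff)
    qed
    ultimately have "(\<lambda>n. \<Sum>i\<le>n. (theta_coeff i * x ^ i) * ((1 - Abs_fps form_coeff) $ (n - i) * x ^ (n - i)))
        sums (qtheta x * (1 - b))"
      using Cauchy_product_sums[of "\<lambda>n. theta_coeff n * x ^ n" "\<lambda>n. (1 - Abs_fps form_coeff) $ n * x ^ n"]
      unfolding sums_unique[OF theta_sums[OF x], symmetric] sums_unique[OF form', symmetric] by blast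
    moreover have "(\<Sum>i\<le>n. (theta_coeff i * x ^ i) * ((1 - Abs_fps form_coeff) $ (n - i) * x ^ (n - i))) = a n * x ^ n" for n
      unfolding a_def sum_distrib_right
    proof (intro sum.cong refl)
      fix i assume "i \<in> {..n}"
      then have "x ^ n = x ^ i * x ^ (n - i)" by (simp flip: power_add)
      then show "(theta_coeff i * x ^ i) * ((1 - Abs_fps form_coeff) $ (n - i) * x ^ (n - i)) =
          theta_coeff i * ((1 - Abs_fps form_coeff) $ (n - i)) * x ^ n" by simp
    qed
    ultimately have "(\<lambda>n. a n * x ^ n) sums (qtheta x * (1 - b))" by simp
    from sums_diff[OF this lambert]
    show "(\<lambda>n. (a n - lambert_coeff n) * x ^ n) sums 0"
      by (simp add: left_diff_distrib)
  qed
  then show "(Abs_fps theta_coeff * (1 - Abs_fps form_coeff)) $ n = Abs_fps lambert_coeff $ n"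
    by (simp add: fps_mult_nth a_def atMost_atLeast0)
qed

section \<open>Divisor sums matching the two evaluations\<close>

lemma sum_divisor_pairs:
  fixes N :: nat
  defines "P \<equiv> {(i, j). i * j = N}"
  assumes "N > 0"
  shows "(\<Sum>(i, j) | i * j = N \<and> odd j. 2 * int i - int j) = (\<Sum>(i, j) | i * j = N. int i)"
proof -
  have fin: "finite P"
    by (rule finite_subset[of _ "{..N} \<times> {..N}"]) (use assms in auto)
  have split: "(\<Sum>p\<in>P. f p) = (\<Sum>p\<in>{p\<in>P. odd (g p)}. f p) + (\<Sum>p\<in>{p\<in>P. even (g p)}. f p)"
    for f :: "nat \<times> nat \<Rightarrow> int" and g :: "nat \<times> nat \<Rightarrow> nat"
    using fin by (subst sum.union_disjoint[symmetric]) (auto intro: arg_cong2[where f = sum])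
  \<comment> \<open>Moving a factor 2 from \<open>i\<close> to \<open>j\<close> trades pairs with
    even \<open>i\<close> for pairs with even \<open>j\<close>. With \<open>split\<close> for either
    component this expresses the sum over odd \<open>i\<close> through sums over
    \<open>j\<close>.\<close>
  have double: "(\<Sum>p\<in>{p\<in>P. even (fst p)}. int (fst p)) = (\<Sum>p\<in>{p\<in>P. even (snd p)}. 2 * int (fst p))"
    by (rule sum.reindex_bij_witness[of _ "\<lambda>(i, j). (2 * i, j div 2)" "\<lambda>(i, j). (i div 2, 2 * j)"])
      (auto simp: P_def elim!: evenE)
  have swap: "(\<Sum>p\<in>{p\<in>P. odd (snd p)}. int (snd p)) = (\<Sum>p\<in>{p\<in>P. odd (fst p)}. int (fst p))"
    by (rule sum.reindex_bij_witness[of _ prod.swap prod.swap]) (auto simp: P_def mult.commute)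
  have "(\<Sum>p\<in>{p\<in>P. odd (snd p)}. 2 * int (fst p) - int (snd p)) =
      2 * (\<Sum>p\<in>{p\<in>P. odd (snd p)}. int (fst p)) - (\<Sum>p\<in>{p\<in>P. odd (fst p)}. int (fst p))"
    by (simp add: sum_subtractf sum_distrib_left swap)
  also have "\<dots> = (\<Sum>p\<in>P. int (fst p))"
    using split[of "\<lambda>p. int (fst p)" fst] split[of "\<lambda>p. int (fst p)" snd] double
    by (simp add: sum_distrib_left[symmetric])
  finally show ?thesis
    by (simp add: P_def case_prod_unfold)
qed

text \<open>For \<open>m > 0\<close> these are the indices of the nonzero terms of
  \<open>partial_theta m $ n\<close>, written multiplicatively.\<close>

definition factor_pairs :: "nat \<Rightarrow> (nat \<times> nat) set" where
  "factor_pairs n = {(k, m). 0 < k \<and> 0 < m \<and> k * (k + m) = n}"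

lemma factor_pairs_subset: "factor_pairs n \<subseteq> {1..n} \<times> {1..n}"
proof -
  have "k \<le> n \<and> m \<le> n" if "0 < k" "0 < m" "k * (k + m) = n" for k m
  proof -
    have "k * 1 \<le> k * (k + m)" "1 * (k + m) \<le> k * (k + m)"
      using that by (intro mult_mono; simp)+
    then show ?thesis unfolding that(3) by simp
  qed
  then show ?thesis by (auto simp: factor_pairs_def Suc_le_eq)
qed

text \<open>For odd \<open>m\<close> exactly one of the factors \<open>k\<close> and
  \<open>k + m\<close> is even. Calling it \<open>2 * i\<close> and the odd one \<open>j\<close>
  gives \<open>i * j = N\<close>, and \<open>(-1)^(k+1) * m = 2*i - j\<close> in both cases.\<close>

lemma sum_factor_pairs_odd:
  "(\<Sum>(k, m)\<in>{(k, m)\<in>factor_pairs n. odd m}. (-1) ^ (k + 1) * int m) =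
   (\<Sum>(s, i) | 2 * (s * i) = n \<and> 0 < n. int i)"
proof (cases "even n \<and> n > 0")
  case False
  have "odd m \<Longrightarrow> even (k * (k + m))" for k m :: nat by auto
  then have "{(k, m)\<in>factor_pairs n. odd m} = {}"
    using False by (auto simp: factor_pairs_def)
  moreover have "{(s, i). 2 * (s * i) = n \<and> 0 < n} = {}" using False by auto
  ultimately show ?thesis by (simp only: sum.empty)
next
  case True
  then obtain N where N: "n = 2 * N" "N > 0" by (auto elim!: evenE)
  have "(\<Sum>(k, m)\<in>{(k, m)\<in>factor_pairs n. odd m}. (-1) ^ (k + 1) * int m) =
      (\<Sum>(i, j) | i * j = N \<and> odd j. 2 * int i - int j)"
  proof (rule sum.reindex_bij_witness[of _ "\<lambda>(i, j). if j < 2 * i then (j, 2 * i - j) else (2 * i, j - 2 * i)"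
        "\<lambda>(k, m). if odd k then ((k + m) div 2, k) else (k div 2, k + m)"])
    let ?i = "\<lambda>(i, j). if j < 2 * i then (j, 2 * i - j) else (2 * i, j - 2 * i)"
    let ?j = "\<lambda>(k, m). if odd k then ((k + m) div 2, k) else (k div 2, k + m)"
    fix p assume "p \<in> {(k, m)\<in>factor_pairs n. odd m}"
    then obtain k m where p: "p = (k, m)" and km: "k * (k + m) = 2 * N" "0 < k" "0 < m" "odd m"
      by (auto simp: factor_pairs_def N)
    consider e where "odd k" "k + m = 2 * e" | e where "even k" "k = 2 * e"
    proof (cases "odd k")
      case True
      then have "even (k + m)" using km(4) by simp
      then obtain e where "k + m = 2 * e" by (elim evenE)
      with True that(1) show ?thesis by blast
    next
      case False
      then have "even k" by simp
      then obtain e where "k = 2 * e" by (elim evenE)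
      with \<open>even k\<close> that(2) show ?thesis by blast
    qed
    then have *: "?i (?j p) = p \<and> ?j p \<in> {(i, j). i * j = N \<and> odd j} \<and>
        (case ?j p of (i, j) \<Rightarrow> 2 * int i - int j) = (case p of (k, m) \<Rightarrow> (-1) ^ (k + 1) * int m)"
    proof cases
      case 1
      have "k * e = N" using km(1) unfolding 1(2) by simp
      moreover have "k < 2 * e" "2 * e - k = m" "2 * int e - int k = int m" using 1(2) km(3) by linarith+
      ultimately show ?thesis using 1 by (simp add: p mult.commute)
    next
      case 2
      have "e * (2 * e + m) = N" using km(1) unfolding 2(2) by simp
      then show ?thesis using 2(2) km by (simp add: p)
    qed
    show "?i (?j p) = p" by (rule *[THEN conjunct1])
    show "?j p \<in> {(i, j). i * j = N \<and> odd j}" by (rule *[THEN conjunct2, THEN conjunct1])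
    show "(case ?j p of (i, j) \<Rightarrow> 2 * int i - int j) = (case p of (k, m) \<Rightarrow> (-1) ^ (k + 1) * int m)"
      by (rule *[THEN conjunct2, THEN conjunct2])
  next
    let ?i = "\<lambda>(i, j). if j < 2 * i then (j, 2 * i - j) else (2 * i, j - 2 * i)"
    let ?j = "\<lambda>(k, m). if odd k then ((k + m) div 2, k) else (k div 2, k + m)"
    fix p assume "p \<in> {(i, j). i * j = N \<and> odd j}"
    then obtain x y where p: "p = (x, y)" and xy: "x * y = N" "odd y" by auto
    have pos: "0 < x" "0 < y" using xy(1) N(2) by (auto intro: Nat.gr0I)
    have *: "?j (?i p) = p \<and> ?i p \<in> {(k, m)\<in>factor_pairs n. odd m}"
    proof (cases "y < 2 * x")
      case True
      then have "y + (2 * x - y) = 2 * x" "odd (2 * x - y)" using xy(2) by simp_all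
      then show ?thesis using True xy pos by (simp add: p factor_pairs_def N(1) mult.commute[of y x])
    next
      case False
      moreover have "y \<noteq> 2 * x" using xy(2) by auto
      ultimately have "2 * x < y" "2 * x + (y - 2 * x) = y" "odd (y - 2 * x)" using xy(2) by simp_all
      then show ?thesis using xy pos by (simp add: p factor_pairs_def N(1))
    qed
    show "?j (?i p) = p" by (rule *[THEN conjunct1])
    show "?i p \<in> {(k, m)\<in>factor_pairs n. odd m}" by (rule *[THEN conjunct2])
  qed
  also have "\<dots> = (\<Sum>(i, j) | i * j = N. int i)"
    by (rule sum_divisor_pairs[OF N(2)])
  also have "\<dots> = (\<Sum>(s, i) | 2 * (s * i) = n \<and> 0 < n. int i)"
    by (rule sum.reindex_bij_witness[of _ prod.swap prod.swap]) (auto simp: N mult.commute)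
  finally show ?thesis .
qed

text \<open>As \<open>n = k * (k + m)\<close>, the sign \<open>(-1)^n\<close> can be absorbed into
  each term. For \<open>m = 2 * i\<close> all signs become \<open>-1\<close>, which is the first
  Lambert sum; for odd \<open>m\<close> the terms are evaluated by
  \<open>sum_factor_pairs_odd\<close>.\<close>

lemma lambert_coeff_eq:
  "lambert_coeff n = (-1) ^ n * ((if n = 0 then 1 else 0)
     + 4 * (\<Sum>m=1..n. (-1) ^ m * real m * partial_theta m $ n))"
proof -
  define F where "F = factor_pairs n"
  have sub: "F \<subseteq> {1..n} \<times> {1..n}"
    unfolding F_def by (rule factor_pairs_subset)
  then have fin: "finite F" by (rule finite_subset) simp
  have F: "(k, m) \<in> F \<longleftrightarrow> k \<in> {1..n} \<and> m \<in> {1..n} \<and> k\<^sup>2 + m * k = n" for k m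
    using sub by (auto simp: F_def factor_pairs_def power2_eq_square algebra_simps)
  have "(\<Sum>m=1..n. (-1) ^ m * real m * partial_theta m $ n) =
      (\<Sum>m=1..n. \<Sum>k=1..n. if (k, m) \<in> F then (-1) ^ m * real m * (2 * (-1) ^ (k + 1)) else 0)"
    unfolding partial_theta_def fps_nth_Abs_fps sum_distrib_left
    by (intro sum.cong refl) (auto simp: F)
  also have "\<dots> = (\<Sum>(k, m)\<in>{1..n} \<times> {1..n}. if (k, m) \<in> F then (-1) ^ m * real m * (2 * (-1) ^ (k + 1)) else 0)"
    by (subst sum.swap) (simp add: sum.cartesian_product)
  also have "\<dots> = (\<Sum>(k, m)\<in>F. (-1) ^ m * real m * (2 * (-1) ^ (k + 1)))"
    using sub by (intro sum.mono_neutral_cong_right) auto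
  finally have 1: "4 * (\<Sum>m=1..n. (-1) ^ m * real m * partial_theta m $ n) =
      (\<Sum>(k, m)\<in>F. 8 * (-1) ^ (m + k + 1) * real m)"
    by (simp add: sum_distrib_left case_prod_unfold power_add mult_ac)
  have split: "(\<Sum>(k, m)\<in>F. f k m) = (\<Sum>(k, m)\<in>{(k, m)\<in>F. even m}. f k m) + (\<Sum>(k, m)\<in>{(k, m)\<in>F. odd m}. f k m)"
    for f :: "nat \<Rightarrow> nat \<Rightarrow> real"
    by (subst sum.union_disjoint[symmetric]) (auto intro: arg_cong2[where f = sum] finite_subset[OF _ fin])
  have sign: "(-1) ^ n = ((-1) ^ (k * (k + m)) :: real)" if "(k, m) \<in> F" for k m
    using that by (auto simp: F_def factor_pairs_def)
  have "(-1) ^ n * (\<Sum>(k, m)\<in>F. 8 * (-1) ^ (m + k + 1) * real m) =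
      (\<Sum>(k, m)\<in>F. 8 * (-1) ^ (k * (k + m) + m + k + 1) * real m)"
    unfolding sum_distrib_left
    by (intro sum.cong refl) (auto simp: sign power_add)
  also have "\<dots> = (\<Sum>(k, m)\<in>{(k, m)\<in>F. even m}. 8 * (-1) ^ (k * (k + m) + m + k + 1) * real m)
      + (\<Sum>(k, m)\<in>{(k, m)\<in>F. odd m}. 8 * (-1) ^ (k * (k + m) + m + k + 1) * real m)"
    by (rule split)
  also have "(\<Sum>(k, m)\<in>{(k, m)\<in>F. even m}. 8 * (-1) ^ (k * (k + m) + m + k + 1) * real m) =
      (\<Sum>(m, i)\<in>{(m, i)\<in>{1..n} \<times> {1..n}. m\<^sup>2 + 2 * m * i = n}. - 16 * real i)"
  proof (rule sum.reindex_bij_witness[of _ "\<lambda>(m, i). (m, 2 * i)" "\<lambda>(k, m). (k, m div 2)"])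
    let ?i = "\<lambda>(m :: nat, i :: nat). (m, 2 * i)" and ?j = "\<lambda>(k :: nat, m :: nat). (k, m div 2)"
    fix p assume "p \<in> {(k, m)\<in>F. even m}"
    then obtain k m where p: "p = (k, m)" "(k, m) \<in> F" "even m" by auto
    from p(3) obtain i where i: "m = 2 * i" by (elim evenE)
    have Fi: "k \<in> {1..n}" "2 * i \<in> {1..n}" "k\<^sup>2 + (2 * i) * k = n"
      using p(2) unfolding F i by blast+
    have "even (k * (k + m) + m + k)" using p(3) by simp
    moreover have "(-1 :: real) ^ (e + 1) = -1" if "even e" for e
      using that by simp
    ultimately have "(-1 :: real) ^ (k * (k + m) + m + k + 1) = -1" by blast
    with Fi have *: "?i (?j p) = p \<and> ?j p \<in> {(m, i)\<in>{1..n} \<times> {1..n}. m\<^sup>2 + 2 * m * i = n} \<and>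
        (case ?j p of (m, i) \<Rightarrow> - 16 * real i) =
        (case p of (k, m) \<Rightarrow> 8 * (-1) ^ (k * (k + m) + m + k + 1) * real m)"
      unfolding p(1) by (simp add: i mult_ac)
    show "?i (?j p) = p" by (rule *[THEN conjunct1])
    show "?j p \<in> {(m, i)\<in>{1..n} \<times> {1..n}. m\<^sup>2 + 2 * m * i = n}"
      by (rule *[THEN conjunct2, THEN conjunct1])
    show "(case ?j p of (m, i) \<Rightarrow> - 16 * real i) =
        (case p of (k, m) \<Rightarrow> 8 * (-1) ^ (k * (k + m) + m + k + 1) * real m)"
      by (rule *[THEN conjunct2, THEN conjunct2])
  next
    let ?i = "\<lambda>(m :: nat, i :: nat). (m, 2 * i)" and ?j = "\<lambda>(k :: nat, m :: nat). (k, m div 2)"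
    fix p assume "p \<in> {(m, i)\<in>{1..n} \<times> {1..n}. m\<^sup>2 + 2 * m * i = n}"
    then obtain m i where p: "p = (m, i)" "0 < m" "0 < i" "m\<^sup>2 + 2 * m * i = n" by auto
    then show "?j (?i p) = p" "?i p \<in> {(k, m)\<in>F. even m}"
      by (simp_all add: F_def factor_pairs_def power2_eq_square distrib_left mult_ac)
  qed
  also have "\<dots> = - 16 * (\<Sum>(m, i)\<in>{1..n} \<times> {1..n}. if m\<^sup>2 + 2 * m * i = n then real i else 0)"
    unfolding sum_distrib_left by (rule sum.mono_neutral_cong_left) (auto split: if_splits)
  also have "(\<Sum>(k, m)\<in>{(k, m)\<in>F. odd m}. 8 * (-1) ^ (k * (k + m) + m + k + 1) * real m) =
      (\<Sum>(k, m)\<in>{(k, m)\<in>F. odd m}. - 8 * of_int ((-1) ^ (k + 1) * int m))"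
  proof (intro sum.cong refl)
    fix p assume "p \<in> {(k, m)\<in>F. odd m}"
    then obtain k m where p: "p = (k, m)" "odd m" by auto
    have "(-1 :: real) ^ (k * (k + m) + m + k + 1) = - ((-1) ^ (k + 1))"
      using p(2) by (cases "even k") (simp_all add: minus_one_power_iff)
    then show "(case p of (k, m) \<Rightarrow> 8 * (-1 :: real) ^ (k * (k + m) + m + k + 1) * real m) =
        (case p of (k, m) \<Rightarrow> - 8 * of_int ((-1) ^ (k + 1) * int m))"
      by (simp only: p(1) prod.case) simp
  qed
  also have "\<dots> = - 8 * of_int (\<Sum>(k, m)\<in>{(k, m)\<in>F. odd m}. (-1) ^ (k + 1) * int m)"
    by (simp add: sum_distrib_left case_prod_unfold)
  also have "(\<Sum>(k, m)\<in>{(k, m)\<in>F. odd m}. (-1) ^ (k + 1) * int m) =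
      (\<Sum>(s, i) | 2 * (s * i) = n \<and> 0 < n. int i)"
    unfolding F_def by (rule sum_factor_pairs_odd)
  also have "\<dots> = (\<Sum>(s, i)\<in>{1..n} \<times> {1..n}. if 2 * s * i = n then int i else 0)"
  proof (rule sum.mono_neutral_cong_left)
    have "s \<in> {1..n} \<and> i \<in> {1..n}" if "2 * (s * i) = n" "0 < n" for s i
    proof -
      have "0 < s" "0 < i" using that by (auto intro: Nat.gr0I)
      then have "s \<le> s * i" "i \<le> s * i" by simp_all
      moreover have "s * i \<le> n" using that(1) by simp
      ultimately have "s \<le> n" "i \<le> n" by (metis le_trans)+
      then show ?thesis using \<open>0 < s\<close> \<open>0 < i\<close> by simp
    qed
    then show "{(s, i). 2 * (s * i) = n \<and> 0 < n} \<subseteq> {1..n} \<times> {1..n}" by auto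
  qed (auto split: if_splits)
  also have "of_int \<dots> = (\<Sum>(s, i)\<in>{1..n} \<times> {1..n}. if 2 * s * i = n then real i else 0)"
    unfolding of_int_sum by (intro sum.cong refl) auto
  finally show ?thesis
    unfolding 1[symmetric] by (simp add: lambert_coeff_def distrib_left)
qed

section \<open>The substitution of \<open>-q\<close> for \<open>q\<close>\<close>

definition fps_alternate :: "real fps \<Rightarrow> real fps" where
  "fps_alternate f = Abs_fps (\<lambda>n. (-1) ^ n * f $ n)"

lemma fps_alternate_mult: "fps_alternate (f * g) = fps_alternate f * fps_alternate g"
proof (rule fps_ext)
  fix n
  have "(-1) ^ n = ((-1) ^ i * (-1) ^ (n - i) :: real)" if "i \<le> n" for i
    using that by (simp flip: power_add)
  then show "fps_alternate (f * g) $ n = (fps_alternate f * fps_alternate g) $ n"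
    by (auto simp: fps_alternate_def fps_mult_nth sum_distrib_left intro!: sum.cong)
qed

lemma fps_alternate_theta: "fps_alternate (1 - partial_theta 0) = Abs_fps theta_coeff"
proof (rule fps_ext)
  fix n
  show "fps_alternate (1 - partial_theta 0) $ n = Abs_fps theta_coeff $ n"
  proof (cases "n > 0 \<and> (\<exists>k. n = k\<^sup>2)")
    case True
    then obtain k where k: "n = k\<^sup>2" "k > 0" by (metis neq0_conv power_zero_numeral)
    have "partial_theta 0 $ n = (\<Sum>j\<in>{k}. 2 * (-1) ^ (j + 1))"
      unfolding partial_theta_def fps_nth_Abs_fps
    proof (intro sum.mono_neutral_cong_right)
      have "k \<le> n" using k by (simp add: power2_eq_square)
      then show "{k} \<subseteq> {1..n}" using k(2) by simp
    qed (use k in \<open>auto simp: power2_eq_iff_nonneg\<close>)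
    then show ?thesis using k by (cases "even k") (auto simp: fps_alternate_def theta_coeff_def)
  next
    case False
    then have "partial_theta 0 $ n = 0"
      by (auto simp: partial_theta_def intro!: sum.neutral)
    then show ?thesis using False by (auto simp: fps_alternate_def theta_coeff_def)
  qed
qed

text \<open>Both sides have the same product with the theta series, which can be cancelled because
  its constant term is 1.\<close>

lemma fps_alternate_rank_gf: "fps_alternate alternating_rank_gf = 1 - Abs_fps form_coeff"
proof -
  have "Abs_fps theta_coeff * fps_alternate alternating_rank_gf = Abs_fps lambert_coeff"
    unfolding fps_alternate_theta[symmetric] fps_alternate_mult[symmetric]
    by (rule fps_ext) (simp add: fps_alternate_def partial_theta_mult_alternating_rank_gf lambert_coeff_eq)
  also have "\<dots> = Abs_fps theta_coeff * (1 - Abs_fps form_coeff)"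
    by (rule theta_mult_form[symmetric])
  finally have "Abs_fps theta_coeff = 0 \<or> fps_alternate alternating_rank_gf = 1 - Abs_fps form_coeff"
    by (simp only: mult_cancel_left)
  moreover have "Abs_fps theta_coeff $ 0 = 1" by (simp add: theta_coeff_def)
  ultimately show ?thesis by (metis fps_zero_nth zero_neq_one)
qed

lemma alternating_rank_gf_nth:
  assumes "n > 0"
  shows "alternating_rank_gf $ n = (-1) ^ (n + 1) * form_coeff n"
proof -
  have "fps_alternate alternating_rank_gf $ n = - form_coeff n"
    unfolding fps_alternate_rank_gf using assms by simp
  then have "(-1) ^ n * ((-1) ^ n * alternating_rank_gf $ n) = (-1) ^ n * (- form_coeff n)"
    by (simp add: fps_alternate_def)
  then show ?thesis by (simp flip: power_mult_distrib mult.assoc)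
qed

section \<open>From the values at \<open>z = -1\<close> and \<open>z = \<i>\<close> to the residue
  classes modulo 4\<close>

lemma sum_box_residues:
  fixes w :: "nat \<Rightarrow> nat \<Rightarrow> 'a::comm_ring_1"
  assumes "n > 0" "\<And>l k. w l k = f ((int l - int k) mod 4)"
  shows "(\<Sum>l=1..n. \<Sum>k=1..n. w l k * rank_fps l k $ n) =
     f 0 * of_nat (Nbar 0 4 n) + f 1 * of_nat (Nbar 1 4 n) + f 2 * of_nat (Nbar 2 4 n) + f 3 * of_nat (Nbar 3 4 n)"
proof -
  define e where "e l k = (of_nat (card (overpartitions_shape l k n)) :: 'a)" for l k
  have N: "of_nat (Nbar a 4 n) = (\<Sum>l=1..n. \<Sum>k=1..n. if (int l - int k) mod 4 = a then e l k else 0)"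
    if "a \<in> {0, 1, 2, 3}" for a
    unfolding Nbar_eq_sum[OF assms(1)] of_nat_sum e_def
    by (intro sum.cong refl) (use that in \<open>auto simp: cong_def\<close>)
  have "w l k * e l k = f 0 * (if (int l - int k) mod 4 = 0 then e l k else 0)
      + f 1 * (if (int l - int k) mod 4 = 1 then e l k else 0)
      + f 2 * (if (int l - int k) mod 4 = 2 then e l k else 0)
      + f 3 * (if (int l - int k) mod 4 = 3 then e l k else 0)" for l k
  proof -
    have "(int l - int k) mod 4 \<in> {0, 1, 2, 3}"
      by (simp only: insert_iff empty_iff) presburger
    then show ?thesis unfolding assms(2) by auto
  qed
  then have "(\<Sum>l=1..n. \<Sum>k=1..n. w l k * e l k) = f 0 * of_nat (Nbar 0 4 n) + f 1 * of_nat (Nbar 1 4 n)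
      + f 2 * of_nat (Nbar 2 4 n) + f 3 * of_nat (Nbar 3 4 n)"
    by (simp add: N sum.distrib sum_distrib_left)
  moreover have "e l k = rank_fps l k $ n" if "l \<in> {1..n}" "k \<in> {1..n}" for l k
    unfolding e_def using that by (intro card_overpartitions_shape) auto
  ultimately show ?thesis by simp
qed

lemma alternating_rank_gf_Nbar:
  assumes "n > 0"
  shows "alternating_rank_gf $ n =
    real (Nbar 0 4 n) - real (Nbar 1 4 n) + real (Nbar 2 4 n) - real (Nbar 3 4 n)"
proof -
  have "(-1) ^ (l + k) = (if even ((int l - int k) mod 4) then 1 else -1 :: real)" for l k
  proof -
    have "even ((int l - int k) mod 4) \<longleftrightarrow> even (l + k)"
      by (simp add: dvd_mod_iff)
    then show ?thesis by simp
  qed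
  from sum_box_residues[where w = "\<lambda>l k. (-1) ^ (l + k)" and f = "\<lambda>d. if even d then 1 else -1", OF assms this]
  show ?thesis
    using assms by (simp add: alternating_rank_gf_def)
qed

definition i_power :: "int \<Rightarrow> complex" where
  "i_power d = (if d = 0 then 1 else if d = 1 then \<i> else if d = 2 then -1 else -\<i>)"

lemma i_power_residue: "\<i> ^ l * (-\<i>) ^ k = i_power ((int l - int k) mod 4)"
proof -
  have m: "\<i> ^ j = \<i> ^ (j mod 4)" for j
  proof -
    have "\<i> ^ j = \<i> ^ (4 * (j div 4) + j mod 4)" by simp
    also have "\<dots> = (\<i> ^ 4) ^ (j div 4) * \<i> ^ (j mod 4)" by (simp only: power_add power_mult)
    finally show ?thesis by (simp add: power4_eq_xxxx)
  qed
  \<comment> \<open>Writing \<open>-\<i>\<close> as a cube replaces the exponent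
    \<open>l - k\<close> by the natural number \<open>l + 3 * k\<close>.\<close>
  have "(-\<i>) = \<i> ^ 3" by (simp add: power3_eq_cube)
  then have "\<i> ^ l * (-\<i>) ^ k = \<i> ^ ((l + 3 * k) mod 4)"
    by (simp add: m[symmetric] power_add power_mult)
  moreover have "int ((l + 3 * k) mod 4) = (int l - int k) mod 4"
    by (simp add: zmod_int) presburger
  moreover have "\<i> ^ j = i_power (int j)" if "j < 4" for j
    using that by (auto simp: i_power_def numeral_eq_Suc less_Suc_eq)
  ultimately show ?thesis by (metis mod_less_divisor zero_less_numeral)
qed

text \<open>The coefficients of \<open>R(\<i>)\<close> are real: the imaginary part equates the
  classes 1 and 3, the real part compares the classes 0 and 2.\<close>

lemma Nbar_4_relations:
  assumes "n > 0"
  shows "Nbar 1 4 n = Nbar 3 4 n"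
    and "int (Nbar 0 4 n) - int (Nbar 2 4 n) = (if \<exists>k. n = k\<^sup>2 then 2 else 0)"
proof -
  have "rank_gf \<i> (-\<i>) 0 0 $ n = (\<Sum>l=1..n. \<Sum>k=1..n. \<i> ^ l * (-\<i>) ^ k * rank_fps l k $ n)"
    by (simp add: rank_gf_def rank_term_def)
  also have "\<dots> = of_nat (Nbar 0 4 n) + \<i> * of_nat (Nbar 1 4 n) - of_nat (Nbar 2 4 n) - \<i> * of_nat (Nbar 3 4 n)"
    by (subst sum_box_residues[where w = "\<lambda>l k. \<i> ^ l * (-\<i>) ^ k", OF assms i_power_residue])
      (simp add: i_power_def)
  finally have *: "of_nat (Nbar 0 4 n) + \<i> * of_nat (Nbar 1 4 n) - of_nat (Nbar 2 4 n) - \<i> * of_nat (Nbar 3 4 n) =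
      (if \<exists>k. n = k\<^sup>2 then 2 else 0)"
    unfolding rank_gf_ii_nth[OF assms] by simp
  have "real (Nbar 1 4 n) - real (Nbar 3 4 n) = 0"
    using arg_cong[OF *, of Im] by (simp split: if_splits)
  then show "Nbar 1 4 n = Nbar 3 4 n" by simp
  have "real (Nbar 0 4 n) - real (Nbar 2 4 n) = (if \<exists>k. n = k\<^sup>2 then 2 else 0)"
    using arg_cong[OF *, of Re] by (simp split: if_splits)
  then show "int (Nbar 0 4 n) - int (Nbar 2 4 n) = (if \<exists>k. n = k\<^sup>2 then 2 else 0)"
    by (simp split: if_splits)
qed

theorem theorem5:
  fixes n :: nat
  assumes "n \<ge> 1"
  shows "(odd n \<longrightarrow> Nbar 0 4 n > Nbar 1 4 n) \<and>
         (even n \<longrightarrow> Nbar 0 4 n < Nbar 1 4 n) \<and>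
         (odd n \<and> n \<noteq> 1 \<longrightarrow> Nbar 1 4 n < Nbar 2 4 n) \<and>
         (even n \<longrightarrow> Nbar 1 4 n > Nbar 2 4 n) \<and>
         int (Nbar 0 4 n) - int (Nbar 2 4 n) = (if \<exists>k. n = k\<^sup>2 then 2 else 0)"
proof -
  have n: "n > 0" using assms by simp
  note diff = Nbar_4_relations(2)[OF n]
  show ?thesis
  \<comment> \<open>The bound \<open>form_coeff n \<ge> 4\<close> is available from
    \<open>n = 2\<close> on.\<close>
  proof (cases "n = 1")
    case True
    then show ?thesis using diff Nbar_4_1 by auto
  next
    case False
    then have "form_coeff n \<ge> 4" using n by (intro form_coeff_ge) auto
    moreover have "real (Nbar 0 4 n) - 2 * real (Nbar 1 4 n) + real (Nbar 2 4 n) = (-1) ^ (n + 1) * form_coeff n"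
      using alternating_rank_gf_nth[OF n] alternating_rank_gf_Nbar[OF n] Nbar_4_relations(1)[OF n] by simp
    \<comment> \<open>The classes 0 and 2 differ by at most 2, so a gap of 4 between their sum and
      \<open>2 * Nbar 1 4 n\<close> puts both strictly on the same side of
      \<open>Nbar 1 4 n\<close>.\<close>
    ultimately have "odd n \<Longrightarrow> Nbar 0 4 n + Nbar 2 4 n \<ge> 2 * Nbar 1 4 n + 4"
      "even n \<Longrightarrow> Nbar 0 4 n + Nbar 2 4 n + 4 \<le> 2 * Nbar 1 4 n" by (simp; linarith)+
    with diff show ?thesis by (auto split: if_splits)
  qed
qed

end
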